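(* Let $1\le k\le n-1$, and let $K$ be an origin-symmetric star body in $\mathbb{R}^n$. Then $$\mathrm{as}(K)\le b_{n,k}^k\, d_{\rm ovr}^k(K,\mathcal{BP}_k^n)\, |K|^{\frac{k}{n}}\, \max_{E\in \mathrm{Gr}_{n-k}} \mathrm{as}(K\cap E),$$ where $$b_{n,k}^k=\frac{\omega_{n-1}}{\omega_{n-k-1}\,\omega_n^{\frac{k}{n}}}.$$ In other words, $\gamma_{n,k}\le b_{n,k}\,d_{\rm ovr}(K,\mathcal{BP}_k^n)$.
   Context: $|\cdot|$ denotes volume in the appropriate dimension (the $0$-dimensional volume of a point is $1$), $\omega_m$ is the volume of the Euclidean unit ball in $\mathbb{R}^m$ ($\omega_0=1$), and $\mathrm{Gr}_{m}$ is the Grassmannian of $m$-dimensional linear subspaces of $\mathbb{R}^n$. A compact set $K\subset\mathbb{R}^n$ is star-shaped at $0$ if it contains the origin in its interior and every line through $0$ meets $K$ in a line segment; its radial function is $\rho_K(\theta)=\max\{\lambda>0:\lambda\theta\in K\}$, $\theta\in S^{n-1}$. If $\rho_K$ is continuous, $K$ is called a star body. Origin-symmetric means $K=-K$. A convex body in $\mathbb{R}^n$ is a compact convex set with non-empty interior; it is centered if its barycenter is at the origin. The average section functional is $\mathrm{as}(K)=\int_{S^{n-1}}|K\cap\xi^\perp|\,d\sigma(\xi)$, where $\sigma$ is the rotationally invariant probability measure on $S^{n-1}$ and $\xi^\perp$ is the hyperplane through $0$ orthogonal to $\xi$. For a linear subspace $E$, $\mathrm{as}(K\cap E)=\int_{S^{n-1}\cap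 E}|K\cap E\cap\xi^\perp|\,d\sigma_E(\xi)$ is the same functional computed inside $E$, where $\sigma_E$ is the rotationally invariant probability measure on $S^{n-1}\cap E$. The constant $\gamma_{n,k}$ is defined as the smallest constant $\gamma>0$ such that for every centered convex body $K$ in $\mathbb{R}^n$ one has $\mathrm{as}(K)\le\gamma^k|K|^{\frac{k}{n}}\max_{E\in\mathrm{Gr}_{n-k}}\mathrm{as}(K\cap E)$. For $1\le k\le n-1$, the spherical Radon transform $R_{n-k}:C(S^{n-1})\to C(\mathrm{Gr}_{n-k})$ is $R_{n-k}g(E)=\int_{S^{n-1}\cap E} g(\theta)\,d\theta$, with $d\theta$ the non-normalized surface measure (counting measure if $\dim E=1$). An origin-symmetric star body $D$ in $\mathbb{R}^n$ is a generalized $k$-intersection body, written $D\in\mathcal{BP}_k^n$, if there is a finite non-negative Borel measure $\mu_D$ on $\mathrm{Gr}_{n-k}$ such that for every $g\in C(S^{n-1})$, $\int_{S^{n-1}}\rho_D^k(\theta) g(\theta)\,d\theta=\int_{\mathrm{Gr}_{n-k}} R_{n-k}g(H)\,d\mu_D(H)$. The outer volume ratio distance is $d_{\rm ovr}(K,\mathcal{BP}_k^n)=\inf\{(|D|/|K|)^{1/n}: K\subset D,\ D\in\mathcal{BP}_k^n\}$, and $d_{\rm ovr}^k$ denotes its $k$-th power.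
   Formalization: In the final sentence, γ_{n,k} is read as the smallest constant for the single body K, not for all centered convex bodies; the literal claim is false (K a ball, k=1, n large: the cube gives γ_{n,1} ≥ about 0.69, while b_{n,1} tends to 0.607). *)

theory Defs
  imports "HOL-Analysis.Analysis"
begin

definition onb :: "'a::euclidean_space set \<Rightarrow> 'a set" where
  "onb E = (SOME B. B \<subseteq> E \<and> independent B \<and> span B = E \<and>
                    pairwise orthogonal B \<and> (\<forall>b\<in>B. norm b = 1))"

text \<open>
  Lebesgue measure of a linear subspace \<open>E\<close>, as a measure on the Borel sets of the
  ambient space that is carried by \<open>E\<close>.  The construction is that of \<open>lborel\<close>, with an
  orthonormal basis of \<open>E\<close> in place of \<open>Basis\<close>; the result does not depend on the basis.
  For \<open>E = {0}\<close> it is the unit point mass at \<open>0\<close>.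
\<close>
definition subspace_lborel :: "'a::euclidean_space set \<Rightarrow> 'a measure" where
  "subspace_lborel E =
     distr (\<Pi>\<^sub>M b\<in>onb E. (lborel :: real measure)) borel (\<lambda>f. \<Sum>b\<in>onb E. f b *\<^sub>R b)"

text \<open>
  Non-normalized surface measure of the unit sphere of \<open>E\<close>: the measure of \<open>A\<close> is \<open>dim E\<close>
  times the volume of the cone \<open>{t *\<^sub>R \<theta> | 0 < t \<le> 1, \<theta> \<in> A}\<close> (integration in polar
  coordinates; \<open>sgn x = x /\<^sub>R norm x\<close>).  For \<open>dim E = 1\<close> it is the counting measure on the
  two unit vectors of \<open>E\<close>.
\<close>
definition sphere_measure :: "'a::euclidean_space set \<Rightarrow> 'a measure" where
  "sphere_measure E =
     scale_measure (of_nat (dim E))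
       (distr (density (subspace_lborel E) (indicator (cball 0 1))) borel sgn)"

definition sphere_prob :: "'a::euclidean_space set \<Rightarrow> 'a measure" where
  "sphere_prob E = scale_measure (1 / emeasure (sphere_measure E) UNIV) (sphere_measure E)"

definition star_shaped :: "'a::euclidean_space set \<Rightarrow> bool" where
  "star_shaped K \<longleftrightarrow> compact K \<and> 0 \<in> interior K \<and>
     (\<forall>v. v \<noteq> 0 \<longrightarrow> (\<exists>a b. K \<inter> span {v} = closed_segment a b))"

definition radial :: "'a::euclidean_space set \<Rightarrow> 'a \<Rightarrow> real" where
  "radial K \<theta> = Sup {t. 0 < t \<and> t *\<^sub>R \<theta> \<in> K}"

definition star_body :: "'a::euclidean_space set \<Rightarrow> bool" where
  "star_body K \<longleftrightarrow> star_shaped K \<and> continuous_on (sphere 0 1) (radial K)"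

definition origin_symmetric :: "'a::euclidean_space set \<Rightarrow> bool" where
  "origin_symmetric K \<longleftrightarrow> uminus ` K = K"

definition Gr :: "nat \<Rightarrow> 'a::euclidean_space set set" where
  "Gr m = {E. subspace E \<and> dim E = m}"

definition as_in :: "'a::euclidean_space set \<Rightarrow> 'a set \<Rightarrow> real" where
  "as_in E K = (LINT \<xi>:sphere 0 1 \<inter> E|sphere_prob E.
     (let F = E \<inter> {x. x \<bullet> \<xi> = 0} in measure (subspace_lborel F) (K \<inter> F)))"

definition avg_section :: "'a::euclidean_space set \<Rightarrow> real" where
  "avg_section K = as_in UNIV K"

text \<open>
  The supremum below is attained for star bodies, since \<open>E \<mapsto> as_in E K\<close> is then continuous
  on the compact Grassmannian.
\<close>
definition max_as :: "nat \<Rightarrow> 'a::euclidean_space set \<Rightarrow> real" where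
  "max_as m K = (SUP E\<in>Gr m. as_in E K)"

text \<open>
  The usual topology of the Grassmannian, induced by identifying a subspace with the orthogonal
  projection onto it; on a linear subspace, \<open>closest_point\<close> is that projection.
\<close>
definition Gr_topology :: "nat \<Rightarrow> 'a::euclidean_space set topology" where
  "Gr_topology m = pullback_topology (Gr m) (\<lambda>E. Blinfun (closest_point E)) euclidean"

definition Gr_borel :: "nat \<Rightarrow> 'a::euclidean_space set measure" where
  "Gr_borel m = sigma (Gr m) {U. openin (Gr_topology m) U}"

definition Radon :: "('a::euclidean_space \<Rightarrow> real) \<Rightarrow> 'a set \<Rightarrow> real" where
  "Radon g E = (LINT \<theta>:sphere 0 1 \<inter> E|sphere_measure E. g \<theta>)"

definition gen_intersection_body :: "nat \<Rightarrow> 'a::euclidean_space set \<Rightarrow> bool" where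
  "gen_intersection_body k D \<longleftrightarrow> star_body D \<and> origin_symmetric D \<and>
     (\<exists>\<mu>. sets \<mu> = sets (Gr_borel (DIM('a) - k) :: 'a set measure) \<and> finite_measure \<mu> \<and>
       (\<forall>g. continuous_on (sphere 0 1) g \<longrightarrow>
          (LINT \<theta>:sphere 0 1|sphere_measure UNIV. radial D \<theta> ^ k * g \<theta>) =
          (LINT H|\<mu>. Radon g H)))"

text \<open>Extended-real valued, so that an infimum over the empty set would be \<open>\<infinity>\<close>.\<close>
definition d_ovr :: "nat \<Rightarrow> 'a::euclidean_space set \<Rightarrow> ereal" where
  "d_ovr k K = (INF D\<in>{D. K \<subseteq> D \<and> gen_intersection_body k D}.
     ereal ((measure lborel D / measure lborel K) powr (1 / DIM('a))))"

text \<open>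
  The smallest constant in the average section inequality, valid for all bodies of a class
  \<open>\<K>\<close>.  The constant $\gamma_{n,k}$ is obtained for the class of all centered convex bodies;
  for \<open>\<K> = {K}\<close> it is the optimal constant of the individual body \<open>K\<close>.
\<close>
definition gamma_const :: "nat \<Rightarrow> 'a::euclidean_space set set \<Rightarrow> real" where
  "gamma_const k \<K> = Inf {\<gamma>. 0 < \<gamma> \<and>
     (\<forall>K\<in>\<K>. avg_section K \<le>
        \<gamma> ^ k * measure lborel K powr (k / DIM('a)) * max_as (DIM('a) - k) K)}"

definition b_const :: "nat \<Rightarrow> nat \<Rightarrow> real" where
  "b_const n k = root k (unit_ball_vol (n - 1 :: nat) /
     (unit_ball_vol (n - k - 1 :: nat) * unit_ball_vol n powr (k / n)))"

end

theory Submission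
  imports Defs
begin

text \<open>
  In polar coordinates, averaging \<open>|K \<inter> E \<inter> \<xi>\<^sup>\<bottom>|\<close> over the sphere of an \<open>m\<close>-dimensional \<open>E\<close> gives
  \<open>as(K \<inter> E) = \<omega>\<^bsub>m-1\<^esub> \<integral> \<rho>\<^sub>K\<^bsup>m-1\<^esup> d\<sigma>\<^sub>E\<close>. For \<open>K \<subseteq> D\<close> one has
  \<open>\<rho>\<^sub>K\<^bsup>n-1\<^esup> \<le> \<rho>\<^sub>D\<^sup>k \<rho>\<^sub>K\<^bsup>n-k-1\<^esup>\<close>, and for a generalized \<open>k\<close>-intersection body \<open>D\<close> the integral of the
  right-hand side over the sphere is an integral of multiples of \<open>as(K \<inter> H)\<close> with respect to \<open>\<mu>\<^sub>D\<close>,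
  hence at most a multiple of \<open>max as(K \<inter> H)\<close> times the total mass of \<open>\<mu>\<^sub>D\<close>. The total mass is found
  by testing with \<open>g = 1\<close>, and Jensen's inequality bounds it by a power of \<open>|D|\<close>. That the section
  average of a function is its average over the sphere follows from the uniqueness of the reflection
  invariant probability measure on the sphere.
\<close>

section \<open>Lebesgue measure in the coordinates of a frame\<close>

text \<open>The measures of the statement rest on a basis picked by \<open>SOME\<close>, so facts
  about them are derived from facts valid for every orthonormal basis. Uniqueness of Haar measure on
  E gives independence of the basis, and orthogonal invariance follows because an isometry only
  replaces one orthonormal basis by another. The obstacle is that section volumes live on subspaces
  varying with \<xi>. Replacing a section by the unit cylinder over it moves its integrals to the
  fixed space E and makes them Borel functions of \<xi>, so Fubini applies. Invariance is used
  through reflections in vectors of E: they carry any vector of E to any other of the same length,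
  and exponentials turn this transitivity into equality of integrals. The constant arises as
  follows, with m = n - k. Passing from as(K) to the sphere gives \<omega>_{n-1}; passing back to
  as(K \<inter> H) gives 1/\<omega>_{m-1}. The surface areas n \<omega>_n and m \<omega>_m cancel
  against the total mass of \<mu>_D, and Jensen's inequality contributes \<omega>_n^{-k/n}.\<close>

definition frame_measure :: "'a::euclidean_space set \<Rightarrow> 'a measure" where
  "frame_measure B = distr (\<Pi>\<^sub>M b\<in>B. (lborel :: real measure)) borel (\<lambda>f. \<Sum>b\<in>B. f b *\<^sub>R b)"

text \<open>The property behind the choice in \<open>onb\<close>. As a predicate it admits bases
  adapted to a hyperplane or moved by an isometry.\<close>

definition onb_of :: "'a::euclidean_space set \<Rightarrow> 'a set \<Rightarrow> bool" where
  "onb_of B E \<longleftrightarrow> B \<subseteq> E \<and> independent B \<and> span B = E \<and>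
                    pairwise orthogonal B \<and> (\<forall>b\<in>B. norm b = 1)"

lemma sets_frame_measure [simp, measurable_cong]: "sets (frame_measure B) = sets borel"
  by (simp add: frame_measure_def)

lemma space_frame_measure [simp]: "space (frame_measure B) = UNIV"
  by (simp add: frame_measure_def)

lemma measurable_frame_sum [measurable]:
  fixes B :: "'a::euclidean_space set"
  shows "(\<lambda>f. \<Sum>b\<in>B. f b *\<^sub>R b) \<in> borel_measurable (\<Pi>\<^sub>M b\<in>B. (lborel :: real measure))"
proof (rule borel_measurable_sum)
  fix b assume "b \<in> B"
  then have [measurable]: "(\<lambda>f. f b) \<in> borel_measurable (\<Pi>\<^sub>M b\<in>B. (lborel :: real measure))"
    by (metis measurable_component_singleton measurable_lborel1 measurable_cong_sets sets_lborel)
  show "(\<lambda>f. f b *\<^sub>R b) \<in> borel_measurable (\<Pi>\<^sub>M b\<in>B. (lborel :: real measure))"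
    by measurable
qed

lemma nn_integral_frame_measure:
  assumes "f \<in> borel_measurable borel"
  shows "(\<integral>\<^sup>+x. f x \<partial>frame_measure B) = (\<integral>\<^sup>+g. f (\<Sum>b\<in>B. g b *\<^sub>R b) \<partial>(\<Pi>\<^sub>M b\<in>B. lborel))"
  unfolding frame_measure_def by (rule nn_integral_distr) (use assms in auto)

lemma nn_integral_frame_measure_empty:
  assumes [measurable]: "f \<in> borel_measurable borel"
  shows "(\<integral>\<^sup>+x. f x \<partial>frame_measure {}) = f 0"
proof -
  interpret product_sigma_finite "\<lambda>_::'a. lborel :: real measure"
    by standard
  show ?thesis
    by (simp add: nn_integral_frame_measure PiM_empty nn_integral_count_space_finite)
qed

text \<open>Fubini for one coordinate. It is the inductive step of the integral identities for
  frames below.\<close>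

lemma nn_integral_frame_measure_insert:
  fixes f :: "'a::euclidean_space \<Rightarrow> ennreal"
  assumes [measurable]: "f \<in> borel_measurable borel" and "finite B" "b \<notin> B"
  shows "(\<integral>\<^sup>+x. f x \<partial>frame_measure (insert b B)) =
    (\<integral>\<^sup>+t. (\<integral>\<^sup>+x. f (x + t *\<^sub>R b) \<partial>frame_measure B) \<partial>lborel)"
proof -
  interpret product_sigma_finite "\<lambda>_::'a. lborel :: real measure"
    by standard
  have eq: "(\<Sum>c\<in>insert b B. (g(b := t)) c *\<^sub>R c) = (\<Sum>c\<in>B. g c *\<^sub>R c) + t *\<^sub>R b" for g and t :: real
  proof -
    have "(\<Sum>c\<in>B. (g(b := t)) c *\<^sub>R c) = (\<Sum>c\<in>B. g c *\<^sub>R c)"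
      using assms by (intro sum.cong) auto
    then show ?thesis
      using assms by (simp add: add.commute)
  qed
  have "(\<integral>\<^sup>+x. f x \<partial>frame_measure (insert b B)) =
     (\<integral>\<^sup>+g. f (\<Sum>c\<in>insert b B. g c *\<^sub>R c) \<partial>(\<Pi>\<^sub>M b\<in>insert b B. lborel))"
    by (simp add: nn_integral_frame_measure)
  also have "\<dots> = (\<integral>\<^sup>+t. (\<integral>\<^sup>+g. f ((\<Sum>c\<in>B. g c *\<^sub>R c) + t *\<^sub>R b) \<partial>(\<Pi>\<^sub>M b\<in>B. lborel)) \<partial>lborel)"
    using assms(2,3) by (subst product_nn_integral_insert_rev) (auto simp only: eq, measurable)
  also have "\<dots> = (\<integral>\<^sup>+t. (\<integral>\<^sup>+x. f (x + t *\<^sub>R b) \<partial>frame_measure B) \<partial>lborel)"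
    by (simp add: nn_integral_frame_measure)
  finally show ?thesis .
qed

text \<open>The vector splits as w + k b with w in \<open>span B\<close>: the induction hypothesis
  absorbs w, and translation invariance on the real line absorbs k.\<close>

lemma nn_integral_frame_measure_translate:
  fixes f :: "'a::euclidean_space \<Rightarrow> ennreal"
  assumes "finite B" "v \<in> span B" "f \<in> borel_measurable borel"
  shows "(\<integral>\<^sup>+x. f (x + v) \<partial>frame_measure B) = (\<integral>\<^sup>+x. f x \<partial>frame_measure B)"
  using assms
proof (induction B arbitrary: v f)
  case empty
  then show ?case by simp
next
  case (insert b B)
  note [measurable] = insert.prems(2)
  from insert.prems obtain k where k: "v - k *\<^sub>R b \<in> span B"
    by (auto simp: span_insert)
  define w where "w = v - k *\<^sub>R b"
  \<comment> \<open>The shape \<open>k + 1 * t\<close> is the one that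
    \<open>nn_integral_real_affine\<close> expects.\<close>
  have "(\<integral>\<^sup>+x. f (x + v) \<partial>frame_measure (insert b B)) =
     (\<integral>\<^sup>+t. (\<integral>\<^sup>+x. f ((x + w) + (k + 1 * t) *\<^sub>R b) \<partial>frame_measure B) \<partial>lborel)"
    using insert.hyps
    by (subst nn_integral_frame_measure_insert) (auto simp: w_def algebra_simps)
  also have "\<dots> = (\<integral>\<^sup>+t. (\<integral>\<^sup>+x. f (x + (k + 1 * t) *\<^sub>R b) \<partial>frame_measure B) \<partial>lborel)"
    by (intro nn_integral_cong insert.IH) (use k in \<open>auto simp: w_def\<close>)
  also have "\<dots> = (\<integral>\<^sup>+t. (\<integral>\<^sup>+x. f (x + t *\<^sub>R b) \<partial>frame_measure B) \<partial>lborel)"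
  proof -
    interpret product_sigma_finite "\<lambda>_::'a. lborel :: real measure"
      by standard
    interpret finite_product_sigma_finite "\<lambda>_::'a. lborel :: real measure" B
      using insert.hyps by unfold_locales
    have "(\<lambda>t. \<integral>\<^sup>+x. f (x + t *\<^sub>R b) \<partial>frame_measure B) \<in> borel_measurable lborel"
      by (simp add: nn_integral_frame_measure) measurable
    from nn_integral_real_affine[OF this[simplified], of 1 k] show ?thesis by simp
  qed
  also have "\<dots> = (\<integral>\<^sup>+x. f x \<partial>frame_measure (insert b B))"
    using insert.hyps by (subst nn_integral_frame_measure_insert) auto
  finally show ?case .
qed

text \<open>The frame measure of linearly dependent vectors can fail to be sigma-finite, so
  measurability is taken from the product measure of the coordinates.\<close>

lemma measurable_nn_integral_frame_measure [measurable (raw)]: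
  fixes f :: "'b \<Rightarrow> 'a::euclidean_space \<Rightarrow> ennreal"
  assumes "finite B" and [measurable]: "(\<lambda>(y, x). f y x) \<in> borel_measurable (M \<Otimes>\<^sub>M borel)"
  shows "(\<lambda>y. \<integral>\<^sup>+x. f y x \<partial>frame_measure B) \<in> borel_measurable M"
proof -
  interpret product_sigma_finite "\<lambda>_::'a. lborel :: real measure"
    by standard
  interpret finite_product_sigma_finite "\<lambda>_::'a. lborel :: real measure" B
    using assms(1) by unfold_locales
  have "(\<lambda>y. \<integral>\<^sup>+g. f y (\<Sum>b\<in>B. g b *\<^sub>R b) \<partial>(\<Pi>\<^sub>M b\<in>B. lborel)) \<in> borel_measurable M"
    by measurable
  then show ?thesis
    by (rule measurable_cong[THEN iffD1, rotated]) (simp add: nn_integral_frame_measure)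
qed

lemma nn_integral_frame_measure_scale:
  fixes f :: "'a::euclidean_space \<Rightarrow> ennreal"
  assumes "finite B" "c > 0" "f \<in> borel_measurable borel"
  shows "(\<integral>\<^sup>+x. f x \<partial>frame_measure B) =
    ennreal (c ^ card B) * (\<integral>\<^sup>+x. f (c *\<^sub>R x) \<partial>frame_measure B)"
  using assms(1,3)
proof (induction B arbitrary: f)
  case empty
  then show ?case by (simp add: nn_integral_frame_measure_empty)
next
  case (insert b B)
  note [measurable] = insert.prems and [simp] = insert.hyps
  have "(\<integral>\<^sup>+x. f x \<partial>frame_measure (insert b B)) =
     (\<integral>\<^sup>+t. (\<integral>\<^sup>+x. f (x + t *\<^sub>R b) \<partial>frame_measure B) \<partial>lborel)"
    by (subst nn_integral_frame_measure_insert) auto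
  also have "\<dots> = ennreal \<bar>c\<bar> *
      (\<integral>\<^sup>+t. (\<integral>\<^sup>+x. f (x + (0 + c * t) *\<^sub>R b) \<partial>frame_measure B) \<partial>lborel)"
    by (intro nn_integral_real_affine) (measurable, use \<open>c > 0\<close> in simp)
  also have "(\<integral>\<^sup>+t. (\<integral>\<^sup>+x. f (x + (0 + c * t) *\<^sub>R b) \<partial>frame_measure B) \<partial>lborel) =
     (\<integral>\<^sup>+t. ennreal (c ^ card B) * (\<integral>\<^sup>+x. f (c *\<^sub>R x + (0 + c * t) *\<^sub>R b) \<partial>frame_measure B) \<partial>lborel)"
    by (intro nn_integral_cong insert.IH) auto
  also have "\<dots> = ennreal (c ^ card B) *
     (\<integral>\<^sup>+t. (\<integral>\<^sup>+x. f (c *\<^sub>R x + (0 + c * t) *\<^sub>R b) \<partial>frame_measure B) \<partial>lborel)"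
    by (rule nn_integral_cmult) measurable
  also have "(\<integral>\<^sup>+t. (\<integral>\<^sup>+x. f (c *\<^sub>R x + (0 + c * t) *\<^sub>R b) \<partial>frame_measure B) \<partial>lborel) =
     (\<integral>\<^sup>+x. f (c *\<^sub>R x) \<partial>frame_measure (insert b B))"
    by (subst nn_integral_frame_measure_insert) (auto simp: algebra_simps)
  finally show ?case
    using \<open>c > 0\<close> by (simp add: ennreal_mult mult.assoc)
qed

text \<open>Injectivity keeps distinct frame vectors distinct, so that each retains its own
  coordinate.\<close>

lemma nn_integral_frame_measure_linear_image:
  fixes f :: "'a::euclidean_space \<Rightarrow> ennreal"
  assumes U: "linear U" "inj U" and "finite B" "f \<in> borel_measurable borel"
  shows "(\<integral>\<^sup>+x. f x \<partial>frame_measure (U ` B)) = (\<integral>\<^sup>+x. f (U x) \<partial>frame_measure B)"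
  using assms(3,4)
proof (induction B arbitrary: f)
  case empty
  have [measurable]: "U \<in> borel_measurable borel"
    using U by (intro borel_measurable_continuous_onI linear_continuous_on linear_conv_bounded_linear[THEN iffD1])
  note [measurable] = empty
  show ?case using U by (simp add: nn_integral_frame_measure_empty linear_0)
next
  case (insert b B)
  have [measurable]: "U \<in> borel_measurable borel"
    using U by (intro borel_measurable_continuous_onI linear_continuous_on linear_conv_bounded_linear[THEN iffD1])
  note [measurable] = insert.prems and [simp] = insert.hyps
  have "U b \<notin> U ` B"
    using U(2) insert.hyps by (simp add: inj_image_mem_iff)
  then have "(\<integral>\<^sup>+x. f x \<partial>frame_measure (U ` insert b B)) =
     (\<integral>\<^sup>+t. (\<integral>\<^sup>+x. f (x + t *\<^sub>R U b) \<partial>frame_measure (U ` B)) \<partial>lborel)"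
    using insert.hyps by (simp add: nn_integral_frame_measure_insert)
  also have "\<dots> = (\<integral>\<^sup>+t. (\<integral>\<^sup>+x. f (U x + t *\<^sub>R U b) \<partial>frame_measure B) \<partial>lborel)"
    by (intro nn_integral_cong insert.IH) auto
  also have "\<dots> = (\<integral>\<^sup>+x. f (U x) \<partial>frame_measure (insert b B))"
    by (subst nn_integral_frame_measure_insert)
      (auto simp: linear_add[OF U(1)] linear_scale[OF U(1)])
  finally show ?case .
qed

lemma AE_frame_measure_span: "AE x in frame_measure B. x \<in> span B"
proof -
  have [measurable]: "span B \<in> sets borel"
    by (simp add: closed_subspace borel_closed)
  have "(\<Sum>b\<in>B. g b *\<^sub>R b) \<in> span B" for g
    by (intro span_sum span_scale span_base)
  then show ?thesis
    unfolding frame_measure_def by (subst AE_distr_iff) auto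
qed

text \<open>By Pythagoras this is the ball in coordinates, whose volume depends only on
  \<open>card B\<close> and \<open>r\<close>. It is the normalisation by which two orthonormal bases
  are compared.\<close>

lemma emeasure_frame_measure_cball:
  assumes "finite B" "pairwise orthogonal B" "\<And>b. b \<in> B \<Longrightarrow> norm b = 1" "r > 0"
  shows "emeasure (frame_measure B) (cball 0 r) = ennreal (unit_ball_vol (card B) * r ^ card B)"
proof -
  have *: "norm (\<Sum>b\<in>B. g b *\<^sub>R b) = sqrt (\<Sum>b\<in>B. (g b)\<^sup>2)" for g :: "'a \<Rightarrow> real"
  proof -
    have "(norm (\<Sum>b\<in>B. g b *\<^sub>R b))\<^sup>2 = (\<Sum>b\<in>B. (norm (g b *\<^sub>R b))\<^sup>2)"
      using assms(1,2) by (intro norm_sum_Pythagorean) (auto simp: pairwise_def orthogonal_def)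
    also have "\<dots> = (\<Sum>b\<in>B. (g b)\<^sup>2)"
      using assms(3) by (intro sum.cong) auto
    finally show ?thesis
      by (metis norm_ge_zero real_sqrt_unique)
  qed
  have "emeasure (frame_measure B) (cball 0 r) =
     emeasure (Pi\<^sub>M B (\<lambda>_. lborel))
             ({f. sqrt (\<Sum>i\<in>B. (f i)\<^sup>2) \<le> r} \<inter> space (Pi\<^sub>M B (\<lambda>_. lborel)))"
    unfolding frame_measure_def
    by (subst emeasure_distr) (auto simp: * intro!: arg_cong[where f = "emeasure _"])
  with emeasure_cball_aux[OF assms(1,4)] show ?thesis by simp
qed

lemma sigma_finite_frame_measure:
  assumes "finite B" "pairwise orthogonal B" "\<And>b. b \<in> B \<Longrightarrow> norm b = 1"
  shows "sigma_finite_measure (frame_measure B)"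
proof
  show "\<exists>A. countable A \<and> A \<subseteq> sets (frame_measure B) \<and> \<Union> A = space (frame_measure B) \<and>
        (\<forall>a\<in>A. emeasure (frame_measure B) a \<noteq> \<infinity>)"
  proof (intro exI[of _ "range (\<lambda>n. cball 0 (real (Suc n)))"] conjI ballI)
    show "\<Union> (range (\<lambda>n. cball 0 (real (Suc n)))) = space (frame_measure B)"
    proof -
      have "\<exists>n. norm x \<le> real (Suc n)" for x :: 'a
        by (meson real_arch_simple le_trans of_nat_le_iff order_trans le_SucI order_refl of_nat_mono)
      then show ?thesis by auto
    qed
  qed (use assms in \<open>auto simp: emeasure_frame_measure_cball simp del: of_nat_Suc\<close>)
qed

section \<open>Uniqueness of translation invariant measures\<close>

text \<open>
  Weil's argument for the uniqueness of Haar measure: \<open>M A * N C\<close> is the double integral of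
  \<open>1\<^sub>A (x + y) 1\<^sub>C y\<close>, and translating in the other variable turns it into \<open>N A * M C\<close>.
\<close>
lemma translation_invariant_measure_unique:
  fixes M N :: "'a::euclidean_space measure"
  assumes [measurable_cong]: "sets M = sets borel" "sets N = sets borel"
    and sf: "sigma_finite_measure M" "sigma_finite_measure N"
    and V: "subspace V" "AE x in M. x \<in> V" "AE x in N. x \<in> V"
    and trM: "\<And>f v. v \<in> V \<Longrightarrow> f \<in> borel_measurable borel \<Longrightarrow>
      (\<integral>\<^sup>+x. f (x + v) \<partial>M) = (\<integral>\<^sup>+x. f x \<partial>M)"
    and trN: "\<And>f v. v \<in> V \<Longrightarrow> f \<in> borel_measurable borel \<Longrightarrow>
      (\<integral>\<^sup>+x. f (x + v) \<partial>N) = (\<integral>\<^sup>+x. f x \<partial>N)"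
    and C: "emeasure M (cball 0 1) = c" "emeasure N (cball 0 1) = c" "c \<noteq> 0" "c \<noteq> \<infinity>"
  shows "M = N"
proof (rule measure_eqI)
  interpret M: sigma_finite_measure M by fact
  interpret N: sigma_finite_measure N by fact
  interpret pair_sigma_finite M N ..
  fix A assume "A \<in> sets M"
  then have [measurable]: "A \<in> sets borel" by (simp add: assms)
  define C where "C = cball (0::'a) 1"
  have [measurable]: "C \<in> sets borel" by (simp add: C_def)
  have "emeasure M A * c = (\<integral>\<^sup>+y. (\<integral>\<^sup>+x. indicator A x \<partial>M) * indicator C y \<partial>N)"
    using C by (simp add: nn_integral_cmult_indicator assms C_def)
  also have "\<dots> = (\<integral>\<^sup>+y. (\<integral>\<^sup>+x. indicator A (x + y) * indicator C y \<partial>M) \<partial>N)"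
  proof (rule nn_integral_cong_AE)
    show "AE y in N. (\<integral>\<^sup>+x. indicator A x \<partial>M) * indicator C y =
      (\<integral>\<^sup>+x. indicator A (x + y) * indicator C y \<partial>M)"
      using V(3)
    proof eventually_elim
      fix y assume "y \<in> V"
      then show "(\<integral>\<^sup>+x. indicator A x \<partial>M) * indicator C y =
        (\<integral>\<^sup>+x. indicator A (x + y) * indicator C y \<partial>M)"
        using trM[of y "indicator A"] by (subst nn_integral_multc) simp_all
    qed
  qed
  also have "\<dots> = (\<integral>\<^sup>+x. (\<integral>\<^sup>+y. indicator A (x + y) * indicator C y \<partial>N) \<partial>M)"
    by (rule Fubini') measurable
  also have "\<dots> = (\<integral>\<^sup>+x. (\<integral>\<^sup>+y. indicator A y * indicator C (y - x) \<partial>N) \<partial>M)"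
  proof (rule nn_integral_cong_AE)
    show "AE x in M. (\<integral>\<^sup>+y. indicator A (x + y) * indicator C y \<partial>N) =
      (\<integral>\<^sup>+y. indicator A y * indicator C (y - x) \<partial>N)"
      using V(2)
    proof eventually_elim
      fix x assume "x \<in> V"
      then show "(\<integral>\<^sup>+y. indicator A (x + y) * indicator C y \<partial>N) =
          (\<integral>\<^sup>+y. indicator A y * indicator C (y - x) \<partial>N)"
        by (subst trN[symmetric, of x]) (simp_all add: add.commute)
    qed
  qed
  also have "\<dots> = (\<integral>\<^sup>+y. (\<integral>\<^sup>+x. indicator A y * indicator C (y - x) \<partial>M) \<partial>N)"
    by (rule Fubini'[symmetric]) measurable
  also have "\<dots> = (\<integral>\<^sup>+y. indicator A y * c \<partial>N)"
  proof (rule nn_integral_cong_AE)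
    show "AE y in N. (\<integral>\<^sup>+x. indicator A y * indicator C (y - x) \<partial>M) = indicator A y * c"
      using V(3)
    proof eventually_elim
      fix y assume "y \<in> V"
      \<comment> \<open>Symmetry of the ball turns y - x into x - y, a translate in x.\<close>
      have "(\<integral>\<^sup>+x. indicator C (y - x) \<partial>M) = (\<integral>\<^sup>+x. indicator C (x + (- y)) \<partial>M)"
        by (intro nn_integral_cong) (auto simp: C_def indicator_def norm_minus_commute)
      also have "\<dots> = (\<integral>\<^sup>+x. indicator C x \<partial>M)"
        using \<open>y \<in> V\<close> V(1) by (intro trM) (auto simp: subspace_neg)
      also have "\<dots> = c"
        using C by (simp add: C_def assms)
      finally show "(\<integral>\<^sup>+x. indicator A y * indicator C (y - x) \<partial>M) = indicator A y * c"
        by (subst nn_integral_cmult) (auto simp: mult.commute)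
    qed
  qed
  also have "\<dots> = emeasure N A * c"
    by (simp add: nn_integral_multc)
  finally show "emeasure M A = emeasure N A"
    using C by (metis ennreal_mult_cancel_left mult.commute infinity_ennreal_def)
qed (simp add: assms)

section \<open>Lebesgue measure of a subspace\<close>

lemma onb_ofD:
  assumes "onb_of B E"
  shows "B \<subseteq> E" "independent B" "span B = E" "pairwise orthogonal B" "\<And>b. b \<in> B \<Longrightarrow> norm b = 1"
    "finite B" "card B = dim E" "subspace E"
  using assms unfolding onb_of_def
  by (auto simp: independent_imp_finite dim_eq_card_independent)

lemma onb_of_exists:
  assumes "subspace E"
  obtains B where "onb_of B E"
  using orthonormal_basis_subspace[OF assms] unfolding onb_of_def by metis

text \<open>Both measures are carried by \<open>E\<close>, are invariant under translations of
  \<open>E\<close> and give the unit ball the same positive finite volume.\<close>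

lemma frame_measure_onb_unique:
  assumes B: "onb_of B E" and B': "onb_of B' E"
  shows "frame_measure B = frame_measure B'"
proof (rule translation_invariant_measure_unique)
  note [simp] = onb_ofD[OF B] onb_ofD[OF B']
  show "sigma_finite_measure (frame_measure B)" "sigma_finite_measure (frame_measure B')"
    by (auto intro!: sigma_finite_frame_measure)
  show "AE x in frame_measure B. x \<in> E" "AE x in frame_measure B'. x \<in> E"
    using AE_frame_measure_span[of B] AE_frame_measure_span[of B'] by simp_all
  show "emeasure (frame_measure B) (cball 0 1) = ennreal (unit_ball_vol (dim E))"
    "emeasure (frame_measure B') (cball 0 1) = ennreal (unit_ball_vol (dim E))"
    by (simp_all add: emeasure_frame_measure_cball)
qed (auto simp: onb_ofD[OF B] onb_ofD[OF B'] nn_integral_frame_measure_translate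
      unit_ball_vol_pos[THEN less_imp_neq, symmetric])

lemma subspace_lborel_eq_frame_measure:
  assumes "onb_of B E"
  shows "subspace_lborel E = frame_measure B"
proof -
  have "onb_of (onb E) E"
    unfolding onb_def onb_of_def[symmetric] using assms by (rule someI)
  moreover have "subspace_lborel E = frame_measure (onb E)"
    by (simp add: subspace_lborel_def frame_measure_def)
  ultimately show ?thesis
    using assms frame_measure_onb_unique by metis
qed

lemma sets_subspace_lborel [simp, measurable_cong]: "sets (subspace_lborel E) = sets borel"
  by (simp add: subspace_lborel_def)

lemma space_subspace_lborel [simp]: "space (subspace_lborel E) = UNIV"
  by (simp add: subspace_lborel_def)

lemma onb_of_Basis: "onb_of Basis (UNIV :: 'a::euclidean_space set)"
  by (auto simp: onb_of_def independent_Basis pairwise_def orthogonal_def inner_Basis)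

lemma subspace_lborel_UNIV: "subspace_lborel UNIV = (lborel :: 'a::euclidean_space measure)"
  unfolding subspace_lborel_eq_frame_measure[OF onb_of_Basis] frame_measure_def
    lborel_def[where 'a = 'a] lborel_eq_real ..

context
  fixes E :: "'a::euclidean_space set"
  assumes E: "subspace E"
begin

lemma sigma_finite_subspace_lborel: "sigma_finite_measure (subspace_lborel E)"
proof -
  obtain B where B: "onb_of B E"
    using onb_of_exists[OF E] .
  then show ?thesis
    using onb_ofD[OF B]
    by (simp add: subspace_lborel_eq_frame_measure sigma_finite_frame_measure)
qed

lemma AE_subspace_lborel: "AE x in subspace_lborel E. x \<in> E"
proof -
  obtain B where B: "onb_of B E"
    using onb_of_exists[OF E] .
  then show ?thesis
    using AE_frame_measure_span[of B] onb_ofD(3)[OF B]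
    unfolding subspace_lborel_eq_frame_measure[OF B] by simp
qed

lemma emeasure_subspace_lborel_cball:
  "r > 0 \<Longrightarrow> emeasure (subspace_lborel E) (cball 0 r) = ennreal (unit_ball_vol (dim E) * r ^ dim E)"
proof -
  assume "r > 0"
  obtain B where B: "onb_of B E"
    using onb_of_exists[OF E] .
  then show ?thesis
    using onb_ofD[OF B] \<open>r > 0\<close>
    by (simp add: subspace_lborel_eq_frame_measure emeasure_frame_measure_cball)
qed

lemma nn_integral_subspace_lborel_scale:
  assumes "c > 0" "f \<in> borel_measurable borel"
  shows "(\<integral>\<^sup>+x. f x \<partial>subspace_lborel E) =
    ennreal (c ^ dim E) * (\<integral>\<^sup>+x. f (c *\<^sub>R x) \<partial>subspace_lborel E)"
proof -
  obtain B where B: "onb_of B E"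
    using onb_of_exists[OF E] .
  then show ?thesis
    using onb_ofD[OF B] assms nn_integral_frame_measure_scale[of B c f]
    by (simp add: subspace_lborel_eq_frame_measure)
qed

text \<open>Scaling by 2 fixes the origin but multiplies its mass by \<open>2 ^ dim E > 1\<close>,
  and the mass is finite because the unit ball has finite volume.\<close>

lemma emeasure_subspace_lborel_0:
  assumes "dim E > 0"
  shows "emeasure (subspace_lborel E) {0} = 0"
proof -
  have "emeasure (subspace_lborel E) {0} = ennreal (2 ^ dim E) * emeasure (subspace_lborel E) {0}"
    using nn_integral_subspace_lborel_scale[of 2 "indicator {0}"]
    by (simp add: indicator_def nn_integral_indicator[symmetric] del: nn_integral_indicator)
  moreover have "emeasure (subspace_lborel E) {0} \<le> emeasure (subspace_lborel E) (cball 0 1)"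
    by (intro emeasure_mono) auto
  then have "emeasure (subspace_lborel E) {0} < \<infinity>"
    using emeasure_subspace_lborel_cball[of 1] by (simp add: le_less_trans)
  then obtain r where r: "emeasure (subspace_lborel E) {0} = ennreal r" "r \<ge> 0"
    by (cases "emeasure (subspace_lborel E) {0}") auto
  ultimately have "r = 2 ^ dim E * r"
    by (simp add: ennreal_mult[symmetric])
  moreover have "(1::real) < 2 ^ dim E"
    using assms by simp
  ultimately show ?thesis
    using r by (cases "r = 0") auto
qed

text \<open>An isometry preserving \<open>E\<close> sends an orthonormal basis of \<open>E\<close>
  to another one, and the measure is the same for both.\<close>

lemma nn_integral_subspace_lborel_orthogonal:
  assumes U: "orthogonal_transformation U" "U ` E = E" and f: "f \<in> borel_measurable borel"
  shows "(\<integral>\<^sup>+x. f (U x) \<partial>subspace_lborel E) = (\<integral>\<^sup>+x. f x \<partial>subspace_lborel E)"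
proof -
  obtain B where B: "onb_of B E"
    using onb_of_exists[OF E] .
  have [simp]: "linear U" "inj U"
    using U by (auto simp: orthogonal_transformation_linear orthogonal_transformation_inj)
  have po: "pairwise orthogonal (U ` B)"
    using onb_ofD(4)[OF B] U(1)
    by (auto simp: pairwise_def orthogonal_def orthogonal_transformation_def)
  have norm: "norm b = 1" if "b \<in> U ` B" for b
    using that onb_ofD(5)[OF B] U(1) by (auto simp: orthogonal_transformation_norm)
  have "independent (U ` B)"
    using po norm[of 0] by (intro pairwise_orthogonal_independent) auto
  then have UB: "onb_of (U ` B) E"
    using onb_ofD(1,3)[OF B] U po norm by (auto simp: onb_of_def span_linear_image)
  have "(\<integral>\<^sup>+x. f (U x) \<partial>subspace_lborel E) = (\<integral>\<^sup>+x. f x \<partial>frame_measure (U ` B))"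
    using onb_ofD[OF B] f
    by (simp add: subspace_lborel_eq_frame_measure[OF B] nn_integral_frame_measure_linear_image)
  then show ?thesis
    by (simp add: subspace_lborel_eq_frame_measure[OF UB])
qed

section \<open>Hyperplane sections of a subspace\<close>

context
  fixes \<xi> :: 'a
  assumes \<xi>: "\<xi> \<in> E" "norm \<xi> = 1"
begin

lemma onb_of_insert_orthogonal:
  assumes B: "onb_of B (E \<inter> {x. x \<bullet> \<xi> = 0})"
  shows "onb_of (insert \<xi> B) E" "\<xi> \<notin> B"
proof -
  have \<xi>1: "\<xi> \<bullet> \<xi> = 1"
    using \<xi> by (simp add: norm_eq_1)
  note B' = onb_ofD[OF B]
  show "\<xi> \<notin> B"
    using \<xi>1 B'(1) by auto
  have orth: "b \<bullet> \<xi> = 0" "\<xi> \<bullet> b = 0" if "b \<in> B" for b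
    using that B'(1) by (auto simp: inner_commute)
  have po: "pairwise orthogonal (insert \<xi> B)"
    using B'(4) orth by (auto simp: pairwise_insert orthogonal_def)
  have "span (insert \<xi> B) = E"
  proof
    show "span (insert \<xi> B) \<subseteq> E"
      using B'(1) \<xi> E by (intro span_minimal) auto
    show "E \<subseteq> span (insert \<xi> B)"
    proof
      fix x assume "x \<in> E"
      then have "x - (x \<bullet> \<xi>) *\<^sub>R \<xi> \<in> E \<inter> {x. x \<bullet> \<xi> = 0}"
        using \<xi> E \<xi>1 by (auto simp: subspace_diff subspace_scale inner_diff_left)
      then show "x \<in> span (insert \<xi> B)"
        using B'(3) by (auto simp: span_insert)
    qed
  qed
  moreover have "independent (insert \<xi> B)"
    using po B'(5)[of 0] \<xi> by (intro pairwise_orthogonal_independent) auto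
  ultimately show "onb_of (insert \<xi> B) E"
    unfolding onb_of_def using po B' \<xi> by auto
qed

lemma subspace_Int_orthogonal: "subspace (E \<inter> {x. x \<bullet> \<xi> = 0})"
  using E by (auto simp: subspace_def inner_add_left)

lemma dim_Int_orthogonal: "dim E = Suc (dim (E \<inter> {x. x \<bullet> \<xi> = 0}))"
proof -
  obtain B where B: "onb_of B (E \<inter> {x. x \<bullet> \<xi> = 0})"
    using onb_of_exists[OF subspace_Int_orthogonal] .
  from onb_of_insert_orthogonal[OF B] show ?thesis
    using onb_ofD(6,7)[OF B] onb_ofD(7)[OF onb_of_insert_orthogonal(1)[OF B]] by simp
qed

text \<open>The hyperplane section is measured by the unit cylinder over it, so that the section
  integrals become integrals over the fixed space \<open>E\<close>, measurable in \<open>\<xi>\<close>.\<close>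
lemma nn_integral_hyperplane_section:
  assumes [measurable]: "f \<in> borel_measurable borel"
  shows "(\<integral>\<^sup>+x. f x \<partial>subspace_lborel (E \<inter> {x. x \<bullet> \<xi> = 0})) =
    (\<integral>\<^sup>+x. f (x - (x \<bullet> \<xi>) *\<^sub>R \<xi>) * indicator {0..1} (x \<bullet> \<xi>) \<partial>subspace_lborel E)"
proof -
  obtain B where B: "onb_of B (E \<inter> {x. x \<bullet> \<xi> = 0})"
    using onb_of_exists[OF subspace_Int_orthogonal] .
  note B' = onb_of_insert_orthogonal[OF B]
  have \<xi>1: "\<xi> \<bullet> \<xi> = 1"
    using \<xi> by (simp add: norm_eq_1)
  have "(\<integral>\<^sup>+x. f (x - (x \<bullet> \<xi>) *\<^sub>R \<xi>) * indicator {0..1} (x \<bullet> \<xi>) \<partial>subspace_lborel E) =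
     (\<integral>\<^sup>+t. (\<integral>\<^sup>+x. f (x + t *\<^sub>R \<xi> - ((x + t *\<^sub>R \<xi>) \<bullet> \<xi>) *\<^sub>R \<xi>) *
        indicator {0..1} ((x + t *\<^sub>R \<xi>) \<bullet> \<xi>) \<partial>frame_measure B) \<partial>lborel)"
    unfolding subspace_lborel_eq_frame_measure[OF B'(1)]
    using onb_ofD(6)[OF B] B'(2) by (subst nn_integral_frame_measure_insert) auto
  \<comment> \<open>On the span of \<open>B\<close>, which is orthogonal to \<xi>, projecting
    removes exactly the term \<open>t *\<^sub>R \<xi>\<close>, and \<open>t\<close> is the height in
    the cylinder.\<close>
  also have "\<dots> = (\<integral>\<^sup>+t. (\<integral>\<^sup>+x. f x * indicator {0..1::real} t \<partial>frame_measure B) \<partial>lborel)"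
  proof -
    have "AE x in frame_measure B. f (x + t *\<^sub>R \<xi> - ((x + t *\<^sub>R \<xi>) \<bullet> \<xi>) *\<^sub>R \<xi>) *
        indicator {0..1} ((x + t *\<^sub>R \<xi>) \<bullet> \<xi>) = f x * indicator {0..1} t" for t :: real
      using AE_frame_measure_span[of B] unfolding onb_ofD(3)[OF B]
      by eventually_elim (simp add: inner_add_left \<xi>1)
    then have "(\<integral>\<^sup>+x. f (x + t *\<^sub>R \<xi> - ((x + t *\<^sub>R \<xi>) \<bullet> \<xi>) *\<^sub>R \<xi>) *
        indicator {0..1} ((x + t *\<^sub>R \<xi>) \<bullet> \<xi>) \<partial>frame_measure B) =
        (\<integral>\<^sup>+x. f x * indicator {0..1} t \<partial>frame_measure B)" for t :: real
      by (rule nn_integral_cong_AE)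
    then show ?thesis
      by (simp only:)
  qed
  also have "\<dots> = (\<integral>\<^sup>+x. f x \<partial>frame_measure B)"
    by (simp add: nn_integral_multc nn_integral_cmult)
  finally show ?thesis
    by (simp add: subspace_lborel_eq_frame_measure[OF B])
qed

end

end

section \<open>Polar coordinates\<close>

lemma unit_ball_vol_of_nat_neq_0 [simp]: "unit_ball_vol (real n) \<noteq> 0"
  by (rule less_imp_neq[THEN not_sym]) simp

lemma sets_sphere_measure [simp, measurable_cong]: "sets (sphere_measure F) = sets borel"
  by (simp add: sphere_measure_def)

lemma sets_sphere_prob [simp, measurable_cong]: "sets (sphere_prob F) = sets borel"
  by (simp add: sphere_prob_def)

lemma space_sphere_measure [simp]: "space (sphere_measure F) = UNIV"
  by (simp add: sphere_measure_def space_scale_measure)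

lemma space_sphere_prob [simp]: "space (sphere_prob F) = UNIV"
  by (simp add: sphere_prob_def space_scale_measure)

context
  fixes E :: "'a::euclidean_space set"
  assumes E: "subspace E"
begin

interpretation sigma_finite_measure "subspace_lborel E"
  by (rule sigma_finite_subspace_lborel[OF E])

interpretation pair_sigma_finite lborel "subspace_lborel E"
  by standard

text \<open>Both sides are evaluations of the double integral over \<open>x\<close> and \<open>t > 0\<close> with density
  \<open>m t\<^sup>m\<^sup>-\<^sup>1 |x|\<^sup>m\<close> on \<open>t|x| \<le> 1\<close>, the right-hand one after the substitution of \<open>x / t\<close> for \<open>x\<close>.\<close>
lemma nn_integral_polar_aux:
  assumes [measurable]: "h \<in> borel_measurable borel" and h: "\<And>x. 0 \<le> h x" and m: "dim E = m" "m > 0"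
  shows "(\<integral>\<^sup>+x. indicator {x. x \<noteq> 0 \<and> norm x \<le> h (sgn x)} x \<partial>subspace_lborel E) =
    (\<integral>\<^sup>+x. ennreal (h (sgn x) ^ m) * indicator {x. x \<noteq> 0 \<and> norm x \<le> 1} x \<partial>subspace_lborel E)"
proof -
  \<comment> \<open>The weight has antiderivative t^m |x|^m in t, hence integrates to 1 over 0 \<le>
    t \<le> 1/|x|.\<close>
  define G where "G = (\<lambda>(t::real, x::'a). ennreal (real m * t ^ (m - 1) * norm x ^ m) *
    indicator {(t, x). x \<noteq> 0 \<and> norm x \<le> h (sgn x) \<and> 0 \<le> t \<and> t * norm x \<le> 1} (t, x))"
  define H where "H = (\<lambda>(t::real, x::'a). ennreal (real m * norm x ^ m / t ^ Suc m) *
    indicator {(t, x). x \<noteq> 0 \<and> norm x \<le> t * h (sgn x) \<and> 0 < t \<and> norm x \<le> 1} (t, x))"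
  have G [measurable]: "G \<in> borel_measurable (borel \<Otimes>\<^sub>M borel)"
    unfolding G_def by measurable
  have H [measurable]: "H \<in> borel_measurable (borel \<Otimes>\<^sub>M borel)"
    unfolding H_def by measurable
  have "(\<integral>\<^sup>+x. indicator {x. x \<noteq> 0 \<and> norm x \<le> h (sgn x)} x \<partial>subspace_lborel E) =
    (\<integral>\<^sup>+x. (\<integral>\<^sup>+t. G (t, x) \<partial>lborel) \<partial>subspace_lborel E)"
  proof (rule nn_integral_cong)
    fix x :: 'a
    show "indicator {x. x \<noteq> 0 \<and> norm x \<le> h (sgn x)} x = (\<integral>\<^sup>+t. G (t, x) \<partial>lborel)"
    proof (cases "x \<noteq> 0 \<and> norm x \<le> h (sgn x)")
      case True
      have "(\<integral>\<^sup>+t. G (t, x) \<partial>lborel) = (\<integral>\<^sup>+t. ennreal (real m * t ^ (m - 1) * norm x ^ m) *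
          indicator {0..1 / norm x} t \<partial>lborel)"
        using True by (intro nn_integral_cong) (auto simp: G_def indicator_def field_simps)
      also have "\<dots> = ennreal ((1 / norm x) ^ m * norm x ^ m - 0 ^ m * norm x ^ m)"
        by (rule nn_integral_FTC_Icc[where F = "\<lambda>t. t ^ m * norm x ^ m"])
          (auto intro!: derivative_eq_intros)
      also have "\<dots> = 1"
        using True m by (simp add: field_simps)
      finally show ?thesis using True by simp
    next
      case False
      then show ?thesis
        by (auto simp: G_def indicator_def)
    qed
  qed
  also have "\<dots> = (\<integral>\<^sup>+t. (\<integral>\<^sup>+x. G (t, x) \<partial>subspace_lborel E) \<partial>lborel)"
    by (rule Fubini) measurable
  also have "\<dots> = (\<integral>\<^sup>+t. (\<integral>\<^sup>+x. H (t, x) \<partial>subspace_lborel E) \<partial>lborel)"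
  proof (rule nn_integral_cong_AE)
    \<comment> \<open>At t = 0 there is no substitution x / t, and for m = 1 the two integrals may
      differ there because 0^0 = 1 in \<open>G\<close>.\<close>
    have "AE t in lborel. t \<noteq> (0::real)"
      by (rule AE_lborel_singleton)
    then show "AE t in lborel. (\<integral>\<^sup>+x. G (t, x) \<partial>subspace_lborel E) = (\<integral>\<^sup>+x. H (t, x) \<partial>subspace_lborel E)"
    proof eventually_elim
      fix t :: real assume "t \<noteq> 0"
      show "(\<integral>\<^sup>+x. G (t, x) \<partial>subspace_lborel E) = (\<integral>\<^sup>+x. H (t, x) \<partial>subspace_lborel E)"
      proof (cases "t > 0")
        case True
        have GH: "ennreal ((1 / t) ^ m) * G (t, (1 / t) *\<^sub>R x) = H (t, x)" for x
        proof -
          have "sgn ((1 / t) *\<^sub>R x) = sgn x"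
            using True by (simp add: sgn_scaleR)
          moreover have "(1 / t) ^ m * (real m * t ^ (m - 1) * norm ((1 / t) *\<^sub>R x) ^ m) =
              real m * norm x ^ m / t ^ Suc m"
            using True m by (cases m) (simp_all add: power_divide field_simps)
          ultimately show ?thesis
            using True
            by (auto simp: G_def H_def indicator_def field_simps ennreal_mult[symmetric] simp del: power_Suc)
        qed
        have "(\<integral>\<^sup>+x. G (t, x) \<partial>subspace_lborel E) =
            ennreal ((1 / t) ^ m) * (\<integral>\<^sup>+x. G (t, (1 / t) *\<^sub>R x) \<partial>subspace_lborel E)"
          unfolding m(1)[symmetric]
          using True by (intro nn_integral_subspace_lborel_scale[OF E]) auto
        also have "\<dots> = (\<integral>\<^sup>+x. H (t, x) \<partial>subspace_lborel E)"
          by (subst nn_integral_cmult[symmetric]) (auto simp: GH)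
        finally show ?thesis .
      next
        case False
        then show ?thesis
          using \<open>t \<noteq> 0\<close> by (simp add: G_def H_def)
      qed
    qed
  qed
  also have "\<dots> = (\<integral>\<^sup>+x. (\<integral>\<^sup>+t. H (t, x) \<partial>lborel) \<partial>subspace_lborel E)"
    by (rule Fubini[symmetric]) measurable
  also have "\<dots> = (\<integral>\<^sup>+x. ennreal (h (sgn x) ^ m) * indicator {x. x \<noteq> 0 \<and> norm x \<le> 1} x \<partial>subspace_lborel E)"
  proof (rule nn_integral_cong)
    fix x :: 'a
    \<comment> \<open>The least t with |x| \<le> t h. The tail integral from \<open>a\<close> to
      infinity has the value |x|^m / a^m, which is h^m.\<close>
    define a where "a = norm x / h (sgn x)"
    show "(\<integral>\<^sup>+t. H (t, x) \<partial>lborel) = ennreal (h (sgn x) ^ m) * indicator {x. x \<noteq> 0 \<and> norm x \<le> 1} x"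
    proof (cases "x \<noteq> 0 \<and> norm x \<le> 1 \<and> h (sgn x) \<noteq> 0")
      case True
      then have hp: "h (sgn x) > 0" using h[of "sgn x"] by simp
      have a: "a > 0" using True hp by (simp add: a_def)
      have t: "norm x \<le> t * h (sgn x) \<and> 0 < t \<longleftrightarrow> a \<le> t" for t
      proof -
        have "norm x \<le> t * h (sgn x) \<longleftrightarrow> a \<le> t"
          using hp by (simp add: a_def pos_divide_le_eq)
        then show ?thesis using a by auto
      qed
      have "(\<integral>\<^sup>+t. H (t, x) \<partial>lborel) = (\<integral>\<^sup>+t. ennreal (real m * norm x ^ m / t ^ Suc m) *
          indicator {a..} t \<partial>lborel)"
        using True t by (intro nn_integral_cong) (auto simp: H_def indicator_def simp del: power_Suc)
      also have "\<dots> = 0 - (- (norm x ^ m / a ^ m))"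
      proof (rule nn_integral_FTC_atLeast[where F = "\<lambda>t. - (norm x ^ m / t ^ m)"])
        fix t assume "a \<le> t"
        then have "t > 0" using a by simp
        have "((\<lambda>t. - (norm x ^ m / t ^ m)) has_real_derivative
            norm x ^ m * (real m * t ^ (m - 1)) / (t ^ m * t ^ m)) (at t)"
          using \<open>t > 0\<close> by (auto intro!: derivative_eq_intros)
        also have "norm x ^ m * (real m * t ^ (m - 1)) / (t ^ m * t ^ m) = real m * norm x ^ m / t ^ Suc m"
          using \<open>t > 0\<close> m by (cases m) (auto simp: field_simps)
        finally show "((\<lambda>t. - (norm x ^ m / t ^ m)) has_real_derivative real m * norm x ^ m / t ^ Suc m) (at t)" .
        show "0 \<le> real m * norm x ^ m / t ^ Suc m"
          using \<open>t > 0\<close> by simp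
      next
        have "filterlim (\<lambda>t::real. t ^ m) at_top at_top"
          using m by (intro filterlim_pow_at_top filterlim_ident)
        then have "((\<lambda>t. - (norm x ^ m / t ^ m)) \<longlongrightarrow> - 0) at_top"
          by (intro tendsto_minus tendsto_divide_0[OF tendsto_const] filterlim_at_top_imp_at_infinity)
        then show "((\<lambda>t. - (norm x ^ m / t ^ m)) \<longlongrightarrow> 0) at_top" by simp
      qed measurable
      also have "0 - (- (norm x ^ m / a ^ m)) = h (sgn x) ^ m"
        using True hp by (simp add: a_def power_divide)
      finally show ?thesis using True by simp
    next
      case False
      then show ?thesis
        using m by (auto simp: H_def indicator_def zero_power)
    qed
  qed
  finally show ?thesis .
qed

text \<open>In positive dimension the origin, where \<open>sgn\<close> gives no direction, is a null
  set and the polar formula applies. In dimension 0 the measure is the point mass at 0 and both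
  sides are 1.\<close>

lemma emeasure_subspace_lborel_star:
  assumes [measurable]: "h \<in> borel_measurable borel" and h: "\<And>x. 0 \<le> h x"
  shows "emeasure (subspace_lborel E) {x. norm x \<le> h (sgn x)} =
    (\<integral>\<^sup>+x. ennreal (h (sgn x) ^ dim E) * indicator (cball 0 1) x \<partial>subspace_lborel E)"
proof (cases "dim E = 0")
  case True
  then have "E = {0}"
    using subspace_0[OF E] by auto
  then have *: "AE x in subspace_lborel E. x = 0"
    using AE_subspace_lborel[OF E] by simp
  have "(\<integral>\<^sup>+x. indicator {x. norm x \<le> h (sgn x)} x \<partial>subspace_lborel E) =
    (\<integral>\<^sup>+x. ennreal (h (sgn x) ^ dim E) * indicator (cball 0 1) x \<partial>subspace_lborel E)"
    by (rule nn_integral_cong_AE, use * in eventually_elim) (auto simp: True h indicator_def)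
  then show ?thesis by simp
next
  case False
  have *: "AE x in subspace_lborel E. x \<noteq> 0"
    using emeasure_subspace_lborel_0[OF E] False by (intro AE_I[where N = "{0}"]) auto
  have "(\<integral>\<^sup>+x. indicator {x. norm x \<le> h (sgn x)} x \<partial>subspace_lborel E) =
    (\<integral>\<^sup>+x. indicator {x. x \<noteq> 0 \<and> norm x \<le> h (sgn x)} x \<partial>subspace_lborel E)"
    by (rule nn_integral_cong_AE, use * in eventually_elim) (auto simp: indicator_def)
  also have "\<dots> = (\<integral>\<^sup>+x. ennreal (h (sgn x) ^ dim E) * indicator {x. x \<noteq> 0 \<and> norm x \<le> 1} x \<partial>subspace_lborel E)"
    using False by (intro nn_integral_polar_aux h) auto
  also have "\<dots> = (\<integral>\<^sup>+x. ennreal (h (sgn x) ^ dim E) * indicator (cball 0 1) x \<partial>subspace_lborel E)"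
    by (rule nn_integral_cong_AE, use * in eventually_elim) (auto simp: indicator_def)
  finally show ?thesis by simp
qed

section \<open>Surface measure and its normalisation\<close>

lemma nn_integral_sphere_measure:
  assumes [measurable]: "f \<in> borel_measurable borel"
  shows "(\<integral>\<^sup>+x. f x \<partial>sphere_measure E) =
    of_nat (dim E) * (\<integral>\<^sup>+x. f (sgn x) * indicator (cball 0 1) x \<partial>subspace_lborel E)"
  unfolding sphere_measure_def
  by (simp add: nn_integral_scale_measure nn_integral_distr,
      subst nn_integral_density) (auto simp: mult.commute intro!: borel_measurable_indicator)

lemma emeasure_sphere_measure: "emeasure (sphere_measure E) UNIV = ennreal (dim E * unit_ball_vol (dim E))"
proof -
  have "emeasure (sphere_measure E) UNIV = (\<integral>\<^sup>+x. 1 \<partial>sphere_measure E)"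
    by simp
  also have "\<dots> = of_nat (dim E) * emeasure (subspace_lborel E) (cball 0 1)"
    by (subst nn_integral_sphere_measure) auto
  finally show ?thesis
    by (simp add: emeasure_subspace_lborel_cball[OF E] ennreal_mult ennreal_of_nat_eq_real_of_nat)
qed

lemma AE_sphere_measure:
  assumes "dim E > 0"
  shows "AE x in sphere_measure E. x \<in> sphere 0 1 \<inter> E"
proof -
  have [measurable]: "E \<in> sets borel"
    by (simp add: closed_subspace[OF E] borel_closed)
  have *: "AE x in subspace_lborel E. x \<noteq> 0"
    using emeasure_subspace_lborel_0[OF E] assms by (intro AE_I[where N = "{0}"]) auto
  have "(\<integral>\<^sup>+x. indicator (- (sphere 0 1 \<inter> E)) x \<partial>sphere_measure E) =
    of_nat (dim E) * (\<integral>\<^sup>+x. indicator (- (sphere 0 1 \<inter> E)) (sgn x) * indicator (cball 0 1) x \<partial>subspace_lborel E)"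
    by (rule nn_integral_sphere_measure) measurable
  also have "(\<integral>\<^sup>+x. indicator (- (sphere 0 1 \<inter> E)) (sgn x) * indicator (cball 0 1) x \<partial>subspace_lborel E) =
     (\<integral>\<^sup>+x. 0 \<partial>subspace_lborel E)"
    by (rule nn_integral_cong_AE, use * AE_subspace_lborel[OF E] in eventually_elim)
      (auto simp: indicator_def norm_sgn sgn_div_norm subspace_scale[OF E])
  finally have "emeasure (sphere_measure E) (- (sphere 0 1 \<inter> E)) = 0"
    by simp
  then show ?thesis
    by (intro AE_I[where N = "- (sphere 0 1 \<inter> E)"]) auto
qed

lemma nn_integral_sphere_prob:
  assumes [measurable]: "f \<in> borel_measurable borel" and m: "dim E > 0"
  shows "(\<integral>\<^sup>+x. f x \<partial>sphere_prob E) = ennreal (1 / (dim E * unit_ball_vol (dim E))) * (\<integral>\<^sup>+x. f x \<partial>sphere_measure E)"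
proof -
  have "1 / ennreal (dim E * unit_ball_vol (dim E)) = ennreal (1 / (dim E * unit_ball_vol (dim E)))"
    using m by (subst divide_ennreal[symmetric]) (auto intro!: mult_pos_pos simp del: dim_eq_0)
  then show ?thesis
    unfolding sphere_prob_def by (simp add: nn_integral_scale_measure emeasure_sphere_measure)
qed

text \<open>The factors \<open>dim E\<close> cancel: the probability is the law of the direction of
  a uniform point of the unit ball. Invariance of Lebesgue measure passes to the sphere in this
  form.\<close>

lemma nn_integral_sphere_prob_cone:
  assumes [measurable]: "f \<in> borel_measurable borel" and m: "dim E > 0"
  shows "(\<integral>\<^sup>+x. f x \<partial>sphere_prob E) =
    ennreal (1 / unit_ball_vol (dim E)) * (\<integral>\<^sup>+x. f (sgn x) * indicator (cball 0 1) x \<partial>subspace_lborel E)"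
proof -
  have "ennreal (1 / (dim E * unit_ball_vol (dim E))) * of_nat (dim E) = ennreal (1 / unit_ball_vol (dim E))"
    using m by (simp add: ennreal_of_nat_eq_real_of_nat ennreal_mult[symmetric] del: dim_eq_0)
  then show ?thesis
    using m by (simp add: nn_integral_sphere_prob nn_integral_sphere_measure mult.assoc[symmetric])
qed

lemma emeasure_sphere_prob_UNIV:
  assumes "dim E > 0"
  shows "emeasure (sphere_prob E) UNIV = 1"
proof -
  have "emeasure (sphere_prob E) UNIV = (\<integral>\<^sup>+x. 1 \<partial>sphere_prob E)"
    by simp
  also have "\<dots> = ennreal (1 / (dim E * unit_ball_vol (dim E))) * emeasure (sphere_measure E) UNIV"
    using assms by (subst nn_integral_sphere_prob) auto
  also have "\<dots> = 1"
    using assms by (simp add: emeasure_sphere_measure ennreal_mult[symmetric] del: dim_eq_0)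
  finally show ?thesis .
qed

lemma AE_sphere_prob:
  assumes "dim E > 0"
  shows "AE x in sphere_prob E. x \<in> sphere 0 1 \<inter> E"
proof -
  have [measurable]: "E \<in> sets borel"
    by (simp add: closed_subspace[OF E] borel_closed)
  have "emeasure (sphere_measure E) (- (sphere 0 1 \<inter> E)) = 0"
    using AE_sphere_measure[OF assms] by (subst (asm) AE_iff_measurable[OF _ refl]) (auto simp: Compl_eq)
  then have "emeasure (sphere_prob E) (- (sphere 0 1 \<inter> E)) = 0"
    by (simp add: sphere_prob_def)
  then show ?thesis
    by (intro AE_I[where N = "- (sphere 0 1 \<inter> E)"]) auto
qed

end

section \<open>Uniqueness of the rotation invariant measure on the sphere\<close>

text \<open>Reflection in the hyperplane orthogonal to \<open>u\<close>; the identity for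
  \<open>u = 0\<close>. Those with \<open>u\<close> in a subspace preserve it and act transitively
  on its spheres, so they stand in for its orthogonal group.\<close>

definition reflection :: "'a::euclidean_space \<Rightarrow> 'a \<Rightarrow> 'a" where
  "reflection u x = x - (2 * (x \<bullet> u) / (u \<bullet> u)) *\<^sub>R u"

lemma linear_reflection: "linear (reflection u)"
  by (rule linearI) (simp_all add: reflection_def algebra_simps inner_add_left add_divide_distrib)

lemma inner_reflection: "reflection u x \<bullet> y = x \<bullet> reflection u y"
  by (simp add: reflection_def inner_diff_left inner_diff_right inner_commute)

lemma reflection_reflection [simp]: "reflection u (reflection u x) = x"
proof (cases "u = 0")
  case False
  then have "reflection u x \<bullet> u = - (x \<bullet> u)"
    by (simp add: reflection_def inner_diff_left)
  then show ?thesis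
    by (simp add: reflection_def)
qed (simp add: reflection_def)

lemma orthogonal_transformation_reflection: "orthogonal_transformation (reflection u)"
  by (simp add: orthogonal_transformation_def linear_reflection inner_reflection)

lemma reflection_in_subspace: "subspace E \<Longrightarrow> u \<in> E \<Longrightarrow> x \<in> E \<Longrightarrow> reflection u x \<in> E"
  by (simp add: reflection_def subspace_diff subspace_scale)

lemma reflection_image_subspace:
  assumes "subspace E" "u \<in> E"
  shows "reflection u ` E = E"
proof
  show "reflection u ` E \<subseteq> E"
    using assms reflection_in_subspace by auto
  show "E \<subseteq> reflection u ` E"
    using assms reflection_in_subspace by (metis image_eqI reflection_reflection subsetI)
qed

text \<open>Equal norms give |s - t|^2 = 2 s \<bullet> (s - t), so the reflection subtracts exactly
  s - t from s.\<close>

lemma reflection_swap: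
  assumes "norm s = norm t"
  shows "reflection (s - t) s = t"
proof (cases "s = t")
  case False
  have st: "s \<bullet> s = t \<bullet> t"
    using assms by (simp add: norm_eq)
  then have "(s - t) \<bullet> (s - t) = 2 * (s \<bullet> (s - t))"
    by (simp add: inner_diff_left inner_diff_right inner_commute)
  moreover have "(s - t) \<bullet> (s - t) \<noteq> 0"
    using False by simp
  ultimately have eq: "2 * (s \<bullet> (s - t)) / ((s - t) \<bullet> (s - t)) = 1"
    by (metis divide_self)
  show ?thesis
    unfolding reflection_def eq by simp
qed (simp add: reflection_def)

lemma borel_measurable_reflection [measurable]: "reflection u \<in> borel_measurable borel"
  unfolding reflection_def by measurable

text \<open>The linear span of the exponentials with frequency in \<open>E\<close>. Products only
  add frequencies, so it is an algebra fit for Stone-Weierstrass, while a reflection of the variable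
  acts simply as a reflection of the frequency.\<close>

inductive_set exp_algebra :: "'a::euclidean_space set \<Rightarrow> ('a \<Rightarrow> real) set" for E where
  exp: "t \<in> E \<Longrightarrow> (\<lambda>x. exp (t \<bullet> x)) \<in> exp_algebra E"
| add: "f \<in> exp_algebra E \<Longrightarrow> g \<in> exp_algebra E \<Longrightarrow> (\<lambda>x. f x + g x) \<in> exp_algebra E"
| scale: "f \<in> exp_algebra E \<Longrightarrow> (\<lambda>x. c * f x) \<in> exp_algebra E"

lemma exp_algebra_mult:
  assumes E: "subspace E" and "f \<in> exp_algebra E" "g \<in> exp_algebra E"
  shows "(\<lambda>x. f x * g x) \<in> exp_algebra E"
  using assms(2)
proof induction
  case (exp t)
  from assms(3) show ?case
  proof induction
    case (exp s)
    have "(\<lambda>x. exp ((t + s) \<bullet> x)) \<in> exp_algebra E"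
      using \<open>t \<in> E\<close> exp E by (intro exp_algebra.exp) (auto simp: subspace_add)
    then show ?case by (simp add: inner_add_left exp_add)
  next
    case (add f g)
    from exp_algebra.add[OF add.IH] show ?case by (simp add: algebra_simps)
  next
    case (scale f c)
    from exp_algebra.scale[OF scale.IH, of c] show ?case by (simp add: algebra_simps)
  qed
next
  case (add f1 f2)
  from exp_algebra.add[OF add.IH] show ?case by (simp add: algebra_simps)
next
  case (scale f c)
  from exp_algebra.scale[OF scale.IH, of c] show ?case by (simp add: algebra_simps)
qed

lemma exp_algebra_continuous: "f \<in> exp_algebra E \<Longrightarrow> continuous_on S f"
  by (induction rule: exp_algebra.induct) (auto intro!: continuous_intros)

lemma function_ring_on_exp_algebra:
  assumes E: "subspace E" and "compact S" "S \<subseteq> E"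
  shows "function_ring_on (exp_algebra E) S"
proof
  fix c :: real
  have "(\<lambda>x. exp (0 \<bullet> x)) \<in> exp_algebra E"
    using E by (intro exp_algebra.exp) (simp add: subspace_0)
  from exp_algebra.scale[OF this, of c] show "(\<lambda>_. c) \<in> exp_algebra E" by simp
next
  fix x y assume xy: "x \<in> S" "y \<in> S" "x \<noteq> y"
  show "\<exists>f\<in>exp_algebra E. f x \<noteq> f y"
  proof (rule bexI)
    have "(x - y) \<bullet> (x - y) \<noteq> 0" using xy by simp
    then show "exp ((x - y) \<bullet> x) \<noteq> exp ((x - y) \<bullet> y)"
      by (simp add: inner_diff_right)
    show "(\<lambda>z. exp ((x - y) \<bullet> z)) \<in> exp_algebra E"
      using xy assms by (intro exp_algebra.exp subspace_diff) auto
  qed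
qed (use assms in \<open>auto intro: exp_algebra_continuous exp_algebra.add exp_algebra_mult\<close>)

text \<open>Its instances below are the normalised surface measure and the average of the surface
  measures of the hyperplane sections.\<close>

locale invariant_sphere_measure =
  fixes E :: "'a::euclidean_space set" and M :: "'a measure"
  assumes E: "subspace E"
    and sets [simp, measurable_cong]: "sets M = sets borel"
    and AE_sphere: "AE x in M. x \<in> sphere 0 1 \<inter> E"
    and emeasure_1: "emeasure M UNIV = 1"
    and invariant: "\<And>u f. u \<in> E \<Longrightarrow> f \<in> borel_measurable borel \<Longrightarrow>
      (\<integral>\<^sup>+x. f (reflection u x) \<partial>M) = (\<integral>\<^sup>+x. f x \<partial>M)"
begin

lemma space [simp]: "space M = UNIV"
  using sets sets_eq_imp_space_eq[OF sets] by simp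

sublocale finite_measure M
  by standard (simp add: emeasure_1)

lemma measure_1: "measure M UNIV = 1"
  by (simp add: measure_def emeasure_1)

text \<open>The reflection taking s to t is self-adjoint, so it moves from the variable to the
  frequency.\<close>

lemma nn_integral_exp_cong:
  assumes "s \<in> E" "t \<in> E" "norm s = norm t"
  shows "(\<integral>\<^sup>+x. ennreal (exp (s \<bullet> x)) \<partial>M) = (\<integral>\<^sup>+x. ennreal (exp (t \<bullet> x)) \<partial>M)"
proof -
  have "(\<integral>\<^sup>+x. ennreal (exp (s \<bullet> x)) \<partial>M) = (\<integral>\<^sup>+x. ennreal (exp (s \<bullet> reflection (s - t) x)) \<partial>M)"
    using assms E by (intro invariant[symmetric]) (auto simp: subspace_diff)
  also have "\<dots> = (\<integral>\<^sup>+x. ennreal (exp (reflection (s - t) s \<bullet> x)) \<partial>M)"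
    by (simp add: inner_reflection)
  finally show ?thesis
    by (simp add: reflection_swap assms)
qed

lemma integrable_bounded_on_sphere:
  fixes f :: "'a \<Rightarrow> real"
  assumes [measurable]: "f \<in> borel_measurable borel" and "\<And>x. x \<in> sphere 0 1 \<inter> E \<Longrightarrow> \<bar>f x\<bar> \<le> B"
  shows "integrable M f"
  by (rule integrable_const_bound[where B = B]) (use AE_sphere assms in auto)

lemma integrable_exp_algebra: "f \<in> exp_algebra E \<Longrightarrow> integrable M f"
proof (induction rule: exp_algebra.induct)
  case (exp t)
  show ?case
  proof (rule integrable_bounded_on_sphere)
    fix x assume "x \<in> sphere 0 1 \<inter> E"
    then show "\<bar>exp (t \<bullet> x)\<bar> \<le> exp (norm t)"
      using norm_cauchy_schwarz[of t x] by simp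
  qed measurable
qed auto

end

text \<open>
  \<open>\<integral> exp (t \<bullet> x) dM\<close> depends only on \<open>|t|\<close>, so averaging it over \<open>t\<close> with respect to \<open>N\<close> and
  interchanging the integrals shows that it is the same for both measures; the exponentials span a
  dense algebra.
\<close>
lemma invariant_sphere_measure_unique:
  fixes f :: "'a::euclidean_space \<Rightarrow> real"
  assumes M: "invariant_sphere_measure E M" and N: "invariant_sphere_measure E N"
    and f: "f \<in> borel_measurable borel" "continuous_on (sphere 0 1 \<inter> E) f"
  shows "(\<integral>x. f x \<partial>M) = (\<integral>x. f x \<partial>N)"
proof -
  interpret M: invariant_sphere_measure E M by fact
  interpret N: invariant_sphere_measure E N by fact
  interpret pair_sigma_finite M N ..
  note E = M.E
  note [measurable] = f(1)
  have exp_eq: "(\<integral>\<^sup>+x. ennreal (exp (t \<bullet> x)) \<partial>M) = (\<integral>\<^sup>+x. ennreal (exp (t \<bullet> x)) \<partial>N)" if t: "t \<in> E" for t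
  proof -
    have *: "(norm t *\<^sub>R y) \<in> E \<and> norm (norm t *\<^sub>R y) = norm t" if "y \<in> sphere 0 1 \<inter> E" for y
      using that E by (simp add: subspace_scale)
    have "(\<integral>\<^sup>+x. ennreal (exp (t \<bullet> x)) \<partial>M) = (\<integral>\<^sup>+y. (\<integral>\<^sup>+x. ennreal (exp (t \<bullet> x)) \<partial>M) \<partial>N)"
      by (simp add: N.emeasure_1)
    also have "\<dots> = (\<integral>\<^sup>+y. (\<integral>\<^sup>+x. ennreal (exp ((norm t *\<^sub>R y) \<bullet> x)) \<partial>M) \<partial>N)"
      by (rule nn_integral_cong_AE, use N.AE_sphere in eventually_elim)
        (intro M.nn_integral_exp_cong, use * t in auto)
    also have "\<dots> = (\<integral>\<^sup>+x. (\<integral>\<^sup>+y. ennreal (exp ((norm t *\<^sub>R y) \<bullet> x)) \<partial>N) \<partial>M)"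
      by (rule Fubini') measurable
    \<comment> \<open>The kernel exp (|t| x \<bullet> y) is symmetric, so x can now serve as the
      direction of the frequency and the inner integral over \<open>N\<close> depends only on
      |t|.\<close>
    also have "\<dots> = (\<integral>\<^sup>+x. (\<integral>\<^sup>+y. ennreal (exp ((norm t *\<^sub>R x) \<bullet> y)) \<partial>N) \<partial>M)"
      by (simp add: inner_commute)
    also have "\<dots> = (\<integral>\<^sup>+x. (\<integral>\<^sup>+y. ennreal (exp (t \<bullet> y)) \<partial>N) \<partial>M)"
      by (rule nn_integral_cong_AE, use M.AE_sphere in eventually_elim)
        (intro N.nn_integral_exp_cong, use * t in auto)
    also have "\<dots> = (\<integral>\<^sup>+x. ennreal (exp (t \<bullet> x)) \<partial>N)"
      by (simp add: M.emeasure_1)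
    finally show ?thesis .
  qed
  have alg: "(\<integral>x. g x \<partial>M) = (\<integral>x. g x \<partial>N)" if "g \<in> exp_algebra E" for g
    using that
  proof induction
    case (exp t)
    then show ?case
      using exp_eq[OF exp] by (simp add: integral_eq_nn_integral)
  next
    case (add f g)
    then show ?case
      by (simp add: M.integrable_exp_algebra N.integrable_exp_algebra)
  qed simp
  have cpt: "compact (sphere 0 1 \<inter> E)"
    by (simp add: compact_Int_closed closed_subspace E)
  interpret function_ring_on "exp_algebra E" "sphere 0 1 \<inter> E"
    by (rule function_ring_on_exp_algebra[OF E cpt]) auto
  obtain B where B: "\<And>x. x \<in> sphere 0 1 \<inter> E \<Longrightarrow> \<bar>f x\<bar> \<le> B"
  proof -
    have "bounded (f ` (sphere 0 1 \<inter> E))"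
      by (rule compact_imp_bounded[OF compact_continuous_image[OF f(2) cpt]])
    then obtain a where "\<forall>x\<in>sphere 0 1 \<inter> E. \<bar>f x\<bar> \<le> a"
      by (auto simp: bounded_iff)
    then show ?thesis
      by (intro that[of a]) blast
  qed
  have intf: "integrable M f" "integrable N f"
    using M.integrable_bounded_on_sphere[OF f(1) B] N.integrable_bounded_on_sphere[OF f(1) B] by auto
  have close: "\<bar>(\<integral>x. f x \<partial>M) - (\<integral>x. f x \<partial>N)\<bar> \<le> 2 * e" if e: "e > 0" for e
  proof -
    obtain g where g: "g \<in> exp_algebra E" "\<And>x. x \<in> sphere 0 1 \<inter> E \<Longrightarrow> \<bar>f x - g x\<bar> < e"
      using Stone_Weierstrass_basic[OF f(2) e] by blast
    have *: "\<bar>(\<integral>x. f x \<partial>L) - (\<integral>x. g x \<partial>L)\<bar> \<le> e" if "invariant_sphere_measure E L" "integrable L f" for L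
    proof -
      interpret L: invariant_sphere_measure E L by fact
      have gi: "integrable L g"
        by (rule L.integrable_exp_algebra[OF g(1)])
      have "\<bar>(\<integral>x. f x \<partial>L) - (\<integral>x. g x \<partial>L)\<bar> = \<bar>\<integral>x. f x - g x \<partial>L\<bar>"
        using that gi by simp
      also have "\<dots> \<le> (\<integral>x. \<bar>f x - g x\<bar> \<partial>L)"
        using integral_norm_bound[of L "\<lambda>x. f x - g x"] by simp
      also have "\<dots> \<le> (\<integral>x. e \<partial>L)"
      proof (rule integral_mono_AE)
        show "AE x in L. \<bar>f x - g x\<bar> \<le> e"
          using L.AE_sphere by eventually_elim (use g(2) in \<open>auto intro: less_imp_le\<close>)
      qed (use that gi in auto)
      also have "\<dots> = e"
        using L.measure_1 by simp
      finally show ?thesis .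
    qed
    from *[OF M intf(1)] *[OF N intf(2)] alg[OF g(1)] show ?thesis by linarith
  qed
  have "\<bar>(\<integral>x. f x \<partial>M) - (\<integral>x. f x \<partial>N)\<bar> \<le> 0"
  proof (rule field_le_epsilon)
    fix e :: real assume "e > 0"
    then show "\<bar>(\<integral>x. f x \<partial>M) - (\<integral>x. f x \<partial>N)\<bar> \<le> 0 + e"
      using close[of "e / 2"] by simp
  qed
  then show ?thesis by simp
qed

text \<open>A reflection commutes with \<open>sgn\<close> and preserves both the unit ball and
  Lebesgue measure on \<open>E\<close>.\<close>

lemma invariant_sphere_prob:
  assumes E: "subspace E" and "dim E > 0"
  shows "invariant_sphere_measure E (sphere_prob E)"
proof
  fix u :: 'a and f :: "'a \<Rightarrow> ennreal"
  assume "u \<in> E" and [measurable]: "f \<in> borel_measurable borel"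
  note U = orthogonal_transformation_reflection[of u] linear_reflection[of u]
    reflection_image_subspace[OF E \<open>u \<in> E\<close>]
  have sgn: "sgn (reflection u x) = reflection u (sgn x)" for x
    by (simp add: sgn_div_norm orthogonal_transformation_norm[OF U(1)] linear_scale[OF U(2)])
  have [measurable]: "cball (0::'a) 1 \<in> sets borel"
    by simp
  have "(\<integral>\<^sup>+x. f (sgn (reflection u x)) * indicator (cball 0 1) (reflection u x) \<partial>subspace_lborel E) =
      (\<integral>\<^sup>+x. f (sgn x) * indicator (cball 0 1) x \<partial>subspace_lborel E)"
    by (rule nn_integral_subspace_lborel_orthogonal[OF E U(1,3)]) measurable
  moreover have "indicator (cball 0 1) (reflection u x) = (indicator (cball 0 1) x :: ennreal)" for x
    by (simp add: indicator_def orthogonal_transformation_norm[OF U(1)])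
  ultimately show "(\<integral>\<^sup>+x. f (reflection u x) \<partial>sphere_prob E) = (\<integral>\<^sup>+x. f x \<partial>sphere_prob E)"
    by (simp add: nn_integral_sphere_prob_cone[OF E _ assms(2)] sgn)
qed (use assms AE_sphere_prob emeasure_sphere_prob_UNIV in auto)

section \<open>Averages of hyperplane sections\<close>

text \<open>For a unit vector \<xi> this is the orthogonal projection onto its hyperplane. It is
  jointly measurable, which makes section integrals measurable in \<xi>.\<close>

definition perp_part :: "'a::euclidean_space \<Rightarrow> 'a \<Rightarrow> 'a" where
  "perp_part \<xi> x = x - (x \<bullet> \<xi>) *\<^sub>R \<xi>"

lemma measurable_perp_part [measurable]:
  "(\<lambda>(\<xi>, x). perp_part \<xi> x) \<in> borel_measurable (borel \<Otimes>\<^sub>M borel)"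
  unfolding perp_part_def by measurable

context
  fixes E :: "'a::euclidean_space set"
  assumes E: "subspace E" and dimE: "dim E > 0"
begin

interpretation sigma_finite_measure "subspace_lborel E"
  by (rule sigma_finite_subspace_lborel[OF E])

interpretation S: invariant_sphere_measure E "sphere_prob E"
  by (rule invariant_sphere_prob[OF E dimE])

lemma nn_integral_iterated_cylinder:
  assumes [measurable]: "f \<in> borel_measurable borel"
  shows "(\<integral>\<^sup>+\<xi>. (\<integral>\<^sup>+x. f (perp_part \<xi> x) * indicator {0..1} (x \<bullet> \<xi>) \<partial>subspace_lborel E) \<partial>sphere_prob E) =
    (\<integral>\<^sup>+\<xi>. (\<integral>\<^sup>+x. f x \<partial>subspace_lborel (E \<inter> {x. x \<bullet> \<xi> = 0})) \<partial>sphere_prob E)"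
  by (rule nn_integral_cong_AE, use S.AE_sphere in eventually_elim)
    (simp add: nn_integral_hyperplane_section[OF E] perp_part_def)

text \<open>The law of a random unit vector: \<xi> is uniform on the sphere of \<open>E\<close>,
  then a point is uniform in the unit ball of the section orthogonal to \<xi>, and its direction is
  taken. The unit cylinder replaces the ball of the section, so that this is a single image of a
  product measure; the scale factor is the inverse volume of that ball.\<close>

definition section_average :: "'a measure" where
  "section_average = scale_measure (ennreal (1 / unit_ball_vol (dim E - 1 :: nat)))
    (distr (density (sphere_prob E \<Otimes>\<^sub>M subspace_lborel E)
        (\<lambda>(\<xi>, x). indicator (cball 0 1) (perp_part \<xi> x) * indicator {0..1} (x \<bullet> \<xi>)))
      borel (\<lambda>(\<xi>, x). sgn (perp_part \<xi> x)))"

lemma sets_section_average [simp, measurable_cong]: "sets section_average = sets borel"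
  by (simp add: section_average_def)

lemma nn_integral_section_average_cylinder:
  assumes [measurable]: "f \<in> borel_measurable borel"
  shows "(\<integral>\<^sup>+x. f x \<partial>section_average) = ennreal (1 / unit_ball_vol (dim E - 1 :: nat)) *
    (\<integral>\<^sup>+\<xi>. (\<integral>\<^sup>+x. f (sgn (perp_part \<xi> x)) * indicator (cball 0 1) (perp_part \<xi> x) *
      indicator {0..1} (x \<bullet> \<xi>) \<partial>subspace_lborel E) \<partial>sphere_prob E)"
proof -
  have [measurable]: "cball (0::'a) 1 \<in> sets borel"
    by simp
  show ?thesis
    unfolding section_average_def
    by (simp add: nn_integral_scale_measure nn_integral_distr nn_integral_density split_beta'
        nn_integral_fst[symmetric] mult_ac)
qed

text \<open>For \<open>dim E \<ge> 2\<close> each section still has a unit sphere, and the cylinder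
  description becomes the mean over these spheres.\<close>

lemma nn_integral_section_average:
  assumes [measurable]: "f \<in> borel_measurable borel" and dimE2: "dim E \<ge> 2"
  shows "(\<integral>\<^sup>+x. f x \<partial>section_average) =
    (\<integral>\<^sup>+\<xi>. (\<integral>\<^sup>+x. f x \<partial>sphere_prob (E \<inter> {x. x \<bullet> \<xi> = 0})) \<partial>sphere_prob E)"
proof -
  have [measurable]: "cball (0::'a) 1 \<in> sets borel"
    by simp
  have "(\<integral>\<^sup>+x. f x \<partial>section_average) =
    (\<integral>\<^sup>+\<xi>. ennreal (1 / unit_ball_vol (dim E - 1 :: nat)) *
      (\<integral>\<^sup>+x. f (sgn (perp_part \<xi> x)) * indicator (cball 0 1) (perp_part \<xi> x) *
        indicator {0..1} (x \<bullet> \<xi>) \<partial>subspace_lborel E) \<partial>sphere_prob E)"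
    by (subst nn_integral_section_average_cylinder, simp, rule nn_integral_cmult[symmetric]) measurable
  also have "\<dots> = (\<integral>\<^sup>+\<xi>. (\<integral>\<^sup>+x. f x \<partial>sphere_prob (E \<inter> {x. x \<bullet> \<xi> = 0})) \<partial>sphere_prob E)"
  proof (rule nn_integral_cong_AE, use S.AE_sphere in eventually_elim)
    fix \<xi> :: 'a assume "\<xi> \<in> sphere 0 1 \<inter> E"
    then have \<xi>: "\<xi> \<in> E" "norm \<xi> = 1" by auto
    let ?F = "E \<inter> {x. x \<bullet> \<xi> = 0}"
    have F: "subspace ?F" "dim ?F = dim E - 1" "dim ?F > 0"
      using subspace_Int_orthogonal[OF E \<xi>] dim_Int_orthogonal[OF E \<xi>] dimE2 by auto
    have "(\<integral>\<^sup>+x. f (sgn x) * indicator (cball 0 1) x \<partial>subspace_lborel ?F) =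
        (\<integral>\<^sup>+x. f (sgn (perp_part \<xi> x)) * indicator (cball 0 1) (perp_part \<xi> x) *
        indicator {0..1} (x \<bullet> \<xi>) \<partial>subspace_lborel E)"
      unfolding perp_part_def by (rule nn_integral_hyperplane_section[OF E \<xi>]) measurable
    then show "ennreal (1 / unit_ball_vol (dim E - 1 :: nat)) *
      (\<integral>\<^sup>+x. f (sgn (perp_part \<xi> x)) * indicator (cball 0 1) (perp_part \<xi> x) *
        indicator {0..1} (x \<bullet> \<xi>) \<partial>subspace_lborel E) = (\<integral>\<^sup>+x. f x \<partial>sphere_prob ?F)"
      using F(2) by (simp add: nn_integral_sphere_prob_cone[OF F(1) assms(1) F(3)])
  qed
  finally show ?thesis .
qed

text \<open>Reflecting \<xi> and x together commutes with the projection and leaves the cylinder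
  unchanged. Lebesgue measure on \<open>E\<close> absorbs the reflection of x, and the surface
  measure absorbs that of \<xi>.\<close>

lemma invariant_section_average:
  assumes dimE2: "dim E \<ge> 2"
  shows "invariant_sphere_measure E section_average"
proof
  have [measurable]: "E \<in> sets borel"
    by (simp add: closed_subspace[OF E] borel_closed)
  have F: "subspace (E \<inter> {x. x \<bullet> \<xi> = 0})" "dim (E \<inter> {x. x \<bullet> \<xi> = 0}) > 0" if "\<xi> \<in> sphere 0 1 \<inter> E" for \<xi>
    using that subspace_Int_orthogonal[OF E, of \<xi>] dim_Int_orthogonal[OF E, of \<xi>] dimE2 by auto
  have "emeasure section_average UNIV = (\<integral>\<^sup>+x. 1 \<partial>section_average)"
    by (simp add: sets_eq_imp_space_eq[OF sets_section_average])
  also have "\<dots> = (\<integral>\<^sup>+\<xi>. (\<integral>\<^sup>+x. 1 \<partial>sphere_prob (E \<inter> {x. x \<bullet> \<xi> = 0})) \<partial>sphere_prob E)"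
    by (rule nn_integral_section_average) (use dimE2 in auto)
  also have "\<dots> = (\<integral>\<^sup>+\<xi>. 1 \<partial>sphere_prob E)"
    by (rule nn_integral_cong_AE, use S.AE_sphere in eventually_elim)
      (simp add: emeasure_sphere_prob_UNIV[OF F])
  finally show "emeasure section_average UNIV = 1"
    by (simp add: S.emeasure_1)
  have "emeasure section_average (- (sphere 0 1 \<inter> E)) = (\<integral>\<^sup>+x. indicator (- (sphere 0 1 \<inter> E)) x \<partial>section_average)"
    by simp
  also have "\<dots> = (\<integral>\<^sup>+\<xi>. (\<integral>\<^sup>+x. indicator (- (sphere 0 1 \<inter> E)) x \<partial>sphere_prob (E \<inter> {x. x \<bullet> \<xi> = 0})) \<partial>sphere_prob E)"
    by (rule nn_integral_section_average) (use dimE2 in auto)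
  also have "\<dots> = (\<integral>\<^sup>+\<xi>. 0 \<partial>sphere_prob E)"
  proof (rule nn_integral_cong_AE, use S.AE_sphere in eventually_elim)
    fix \<xi> assume \<xi>: "\<xi> \<in> sphere 0 1 \<inter> E"
    have "(\<integral>\<^sup>+x. indicator (- (sphere 0 1 \<inter> E)) x \<partial>sphere_prob (E \<inter> {x. x \<bullet> \<xi> = 0})) =
        (\<integral>\<^sup>+x. 0 \<partial>sphere_prob (E \<inter> {x. x \<bullet> \<xi> = 0}))"
      by (rule nn_integral_cong_AE, use AE_sphere_prob[OF F[OF \<xi>]] in eventually_elim) auto
    then show "(\<integral>\<^sup>+x. indicator (- (sphere 0 1 \<inter> E)) x \<partial>sphere_prob (E \<inter> {x. x \<bullet> \<xi> = 0})) = 0"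
      by simp
  qed
  finally show "AE x in section_average. x \<in> sphere 0 1 \<inter> E"
    by (intro AE_I[where N = "- (sphere 0 1 \<inter> E)"]) auto
next
  fix u :: 'a and f :: "'a \<Rightarrow> ennreal"
  assume u: "u \<in> E" and [measurable]: "f \<in> borel_measurable borel"
  have [measurable]: "cball (0::'a) 1 \<in> sets borel"
    by simp
  note R = orthogonal_transformation_reflection[of u] linear_reflection[of u]
    reflection_image_subspace[OF E u]
  have inner: "reflection u x \<bullet> reflection u y = x \<bullet> y" for x y
    by (simp add: inner_reflection)
  have perp: "perp_part (reflection u \<xi>) (reflection u x) = reflection u (perp_part \<xi> x)" for \<xi> x
    by (simp add: perp_part_def inner linear_diff[OF R(2)] linear_scale[OF R(2)])
  have norm: "norm (reflection u x) = norm x" for x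
    by (rule orthogonal_transformation_norm[OF R(1)])
  have sgn: "sgn (reflection u x) = reflection u (sgn x)" for x
    by (simp add: sgn_div_norm norm linear_scale[OF R(2)])
  have ball: "indicator (cball 0 1) (reflection u x) = (indicator (cball 0 1) x :: ennreal)" for x
    by (simp add: indicator_def norm)
  define G where "G f \<xi> = (\<integral>\<^sup>+x. f (sgn (perp_part \<xi> x)) * indicator (cball 0 1) (perp_part \<xi> x) *
      indicator {0..1} (x \<bullet> \<xi>) \<partial>subspace_lborel E)" for f :: "'a \<Rightarrow> ennreal" and \<xi>
  have [measurable]: "G f \<in> borel_measurable borel"
    unfolding G_def by measurable
  have "G (\<lambda>x. f (reflection u x)) \<xi> = G f (reflection u \<xi>)" for \<xi>
  proof -
    have "G f (reflection u \<xi>) = (\<integral>\<^sup>+x. f (sgn (perp_part (reflection u \<xi>) (reflection u x))) *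
        indicator (cball 0 1) (perp_part (reflection u \<xi>) (reflection u x)) *
        indicator {0..1} (reflection u x \<bullet> reflection u \<xi>) \<partial>subspace_lborel E)"
      unfolding G_def by (rule nn_integral_subspace_lborel_orthogonal[OF E R(1,3), symmetric]) measurable
    then show ?thesis
      by (simp add: G_def inner perp sgn ball)
  qed
  moreover have "(\<integral>\<^sup>+\<xi>. G f (reflection u \<xi>) \<partial>sphere_prob E) = (\<integral>\<^sup>+\<xi>. G f \<xi> \<partial>sphere_prob E)"
    using u by (intro S.invariant) auto
  ultimately show "(\<integral>\<^sup>+x. f (reflection u x) \<partial>section_average) = (\<integral>\<^sup>+x. f x \<partial>section_average)"
    by (simp add: nn_integral_section_average_cylinder G_def[of f, symmetric]
        G_def[of "\<lambda>x. f (reflection u x)", symmetric])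
qed (simp_all add: E)

text \<open>Polar coordinates in each section make its volume an integral of h^(m-1) over
  directions, where m = \<open>dim E\<close>. Averaging over \<xi> yields
  \<open>section_average\<close>, which uniqueness replaces by \<open>sphere_prob E\<close>.\<close>

lemma nn_integral_hyperplane_sections:
  assumes [measurable]: "h \<in> borel_measurable borel" and h: "\<And>x. 0 \<le> h x" "\<And>x. h x \<le> R"
    and cont: "continuous_on (sphere 0 1 \<inter> E) h"
  shows "(\<integral>\<^sup>+\<xi>. emeasure (subspace_lborel (E \<inter> {x. x \<bullet> \<xi> = 0})) {x. norm x \<le> h (sgn x)} \<partial>sphere_prob E) =
    ennreal (unit_ball_vol (dim E - 1 :: nat) * (\<integral>x. h x ^ (dim E - 1) \<partial>sphere_prob E))"
proof -
  have [measurable]: "cball (0::'a) 1 \<in> sets borel"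
    by simp
  define c where "c = unit_ball_vol (dim E - 1 :: nat)"
  have c: "c > 0" by (simp add: c_def)
  have bounded: "\<bar>h x ^ (dim E - 1)\<bar> \<le> R ^ (dim E - 1)" for x
    using h[of x] by (simp add: power_mono)
  have sec: "emeasure (subspace_lborel (E \<inter> {x. x \<bullet> \<xi> = 0})) {x. norm x \<le> h (sgn x)} =
      (\<integral>\<^sup>+x. ennreal (h (sgn x) ^ (dim E - 1)) * indicator (cball 0 1) x \<partial>subspace_lborel (E \<inter> {x. x \<bullet> \<xi> = 0}))"
    if "\<xi> \<in> sphere 0 1 \<inter> E" for \<xi>
    using that dim_Int_orthogonal[OF E, of \<xi>]
    by (subst emeasure_subspace_lborel_star[OF subspace_Int_orthogonal[OF E]]) (auto simp: h)
  show ?thesis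
  proof (cases "dim E = 1")
    \<comment> \<open>Here the sections are single points of volume 1 and have no unit sphere, so
      \<open>section_average\<close> is not invoked; the exponent is 0 and both sides are 1.\<close>
    case True
    have "(\<integral>\<^sup>+\<xi>. emeasure (subspace_lborel (E \<inter> {x. x \<bullet> \<xi> = 0})) {x. norm x \<le> h (sgn x)} \<partial>sphere_prob E) =
      (\<integral>\<^sup>+\<xi>. 1 \<partial>sphere_prob E)"
    proof (rule nn_integral_cong_AE, use S.AE_sphere in eventually_elim)
      fix \<xi> assume \<xi>: "\<xi> \<in> sphere 0 1 \<inter> E"
      then have "dim (E \<inter> {x. x \<bullet> \<xi> = 0}) = 0"
        using dim_Int_orthogonal[OF E, of \<xi>] True by simp
      then show "emeasure (subspace_lborel (E \<inter> {x. x \<bullet> \<xi> = 0})) {x. norm x \<le> h (sgn x)} = 1"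
        using \<xi> emeasure_subspace_lborel_cball[OF subspace_Int_orthogonal[OF E, of \<xi>], of 1]
        unfolding sec[OF \<xi>] by (simp add: True del: dim_eq_0)
    qed
    then show ?thesis
      by (simp add: True S.emeasure_1 S.measure_1)
  next
    case False
    then have dimE2: "dim E \<ge> 2" using dimE by simp
    interpret N: invariant_sphere_measure E section_average
      by (rule invariant_section_average[OF dimE2])
    have "(\<integral>\<^sup>+\<xi>. emeasure (subspace_lborel (E \<inter> {x. x \<bullet> \<xi> = 0})) {x. norm x \<le> h (sgn x)} \<partial>sphere_prob E) =
      (\<integral>\<^sup>+\<xi>. (\<integral>\<^sup>+x. ennreal (h (sgn x) ^ (dim E - 1)) * indicator (cball 0 1) x \<partial>subspace_lborel (E \<inter> {x. x \<bullet> \<xi> = 0})) \<partial>sphere_prob E)"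
      by (rule nn_integral_cong_AE, use S.AE_sphere in eventually_elim) (rule sec)
    also have "\<dots> = (\<integral>\<^sup>+\<xi>. (\<integral>\<^sup>+x. ennreal (h (sgn (perp_part \<xi> x)) ^ (dim E - 1)) * indicator (cball 0 1) (perp_part \<xi> x) *
      indicator {0..1} (x \<bullet> \<xi>) \<partial>subspace_lborel E) \<partial>sphere_prob E)"
      by (subst nn_integral_iterated_cylinder[symmetric]) measurable
    also have "\<dots> = ennreal c * (ennreal (1 / c) * \<dots>)"
      using c by (simp add: mult.assoc[symmetric] ennreal_mult[symmetric])
    also have "\<dots> = ennreal c * (\<integral>\<^sup>+x. ennreal (h x ^ (dim E - 1)) \<partial>section_average)"
      unfolding c_def by (subst nn_integral_section_average_cylinder) auto
    also have "(\<integral>\<^sup>+x. ennreal (h x ^ (dim E - 1)) \<partial>section_average) = ennreal (\<integral>x. h x ^ (dim E - 1) \<partial>section_average)"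
      using bounded h by (intro nn_integral_eq_integral N.integrable_bounded_on_sphere) auto
    also have "(\<integral>x. h x ^ (dim E - 1) \<partial>section_average) = (\<integral>x. h x ^ (dim E - 1) \<partial>sphere_prob E)"
      using cont
      by (intro invariant_sphere_measure_unique[OF N.invariant_sphere_measure_axioms
            S.invariant_sphere_measure_axioms] continuous_on_power) auto
    finally show ?thesis
      using c h by (simp add: c_def ennreal_mult integral_nonneg)
  qed
qed

lemma as_in_eq:
  assumes [measurable]: "h \<in> borel_measurable borel" and h: "\<And>x. 0 \<le> h x" "\<And>x. h x \<le> R"
    and cont: "continuous_on (sphere 0 1 \<inter> E) h"
  shows "as_in E {x. norm x \<le> h (sgn x)} =
    unit_ball_vol (dim E - 1 :: nat) * (\<integral>x. h x ^ (dim E - 1) \<partial>sphere_prob E)"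
proof -
  let ?K = "{x. norm x \<le> h (sgn x)}"
  let ?F = "\<lambda>\<xi>. E \<inter> {x. x \<bullet> \<xi> = 0}"
  \<comment> \<open>A Borel function on the whole space that agrees with the section volume for unit
    vectors of \<open>E\<close>. It allows passing from the real integrals in \<open>as_in\<close>
    to non-negative ones.\<close>
  define \<Phi> where "\<Phi> \<xi> = (\<integral>\<^sup>+x. indicator ?K (perp_part \<xi> x) * indicator {0..1} (x \<bullet> \<xi>) \<partial>subspace_lborel E)" for \<xi>
  have [measurable]: "E \<in> sets borel"
    by (simp add: closed_subspace[OF E] borel_closed)
  have [measurable]: "sphere (0::'a) 1 \<in> sets borel"
    by simp
  have [measurable]: "\<Phi> \<in> borel_measurable borel"
    unfolding \<Phi>_def by measurable
  have \<Phi>: "\<Phi> \<xi> = emeasure (subspace_lborel (?F \<xi>)) ?K" if "\<xi> \<in> sphere 0 1 \<inter> E" for \<xi>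
    using that nn_integral_hyperplane_section[OF E, of \<xi> "indicator ?K"]
    by (simp add: \<Phi>_def perp_part_def)
  have meas: "measure (subspace_lborel (?F \<xi>)) (?K \<inter> ?F \<xi>) = enn2real (\<Phi> \<xi>)" and fin: "\<Phi> \<xi> < \<infinity>"
    if \<xi>: "\<xi> \<in> sphere 0 1 \<inter> E" for \<xi>
  proof -
    have F: "subspace (?F \<xi>)"
      using \<xi> by (intro subspace_Int_orthogonal[OF E]) auto
    have [measurable]: "?F \<xi> \<in> sets borel"
      by (intro borel_closed closed_subspace F)
    have "emeasure (subspace_lborel (?F \<xi>)) (?K \<inter> ?F \<xi>) = emeasure (subspace_lborel (?F \<xi>)) ?K"
      by (rule emeasure_eq_AE, use AE_subspace_lborel[OF F] in eventually_elim) auto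
    then show "measure (subspace_lborel (?F \<xi>)) (?K \<inter> ?F \<xi>) = enn2real (\<Phi> \<xi>)"
      by (simp add: \<Phi>[OF \<xi>] measure_def)
    have "emeasure (subspace_lborel (?F \<xi>)) ?K \<le> emeasure (subspace_lborel (?F \<xi>)) (cball 0 (max R 1))"
      using order_trans[OF _ h(2)] by (intro emeasure_mono) (auto simp: le_max_iff_disj)
    also have "\<dots> < \<infinity>"
      by (subst emeasure_subspace_lborel_cball[OF F]) auto
    finally show "\<Phi> \<xi> < \<infinity>"
      by (simp add: \<Phi>[OF \<xi>])
  qed
  have "as_in E ?K = (\<integral>\<xi>. indicator (sphere 0 1 \<inter> E) \<xi> * enn2real (\<Phi> \<xi>) \<partial>sphere_prob E)"
    unfolding as_in_def set_lebesgue_integral_def Let_def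
    by (intro Bochner_Integration.integral_cong) (auto simp: indicator_def meas)
  also have "\<dots> = enn2real (\<integral>\<^sup>+\<xi>. ennreal (indicator (sphere 0 1 \<inter> E) \<xi> * enn2real (\<Phi> \<xi>)) \<partial>sphere_prob E)"
  proof (rule integral_eq_nn_integral)
    have "sphere 0 1 \<inter> E \<in> sets borel"
      by simp
    then show "(\<lambda>\<xi>. indicator (sphere 0 1 \<inter> E) \<xi> * enn2real (\<Phi> \<xi>)) \<in> borel_measurable (sphere_prob E)"
      unfolding measurable_cong_sets[OF sets_sphere_prob refl]
      by (intro borel_measurable_times borel_measurable_indicator borel_measurable_enn2real) measurable
  qed simp
  also have "(\<integral>\<^sup>+\<xi>. ennreal (indicator (sphere 0 1 \<inter> E) \<xi> * enn2real (\<Phi> \<xi>)) \<partial>sphere_prob E) =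
     (\<integral>\<^sup>+\<xi>. emeasure (subspace_lborel (?F \<xi>)) ?K \<partial>sphere_prob E)"
    by (rule nn_integral_cong_AE, use S.AE_sphere in eventually_elim) (use fin in \<open>simp add: \<Phi>\<close>)
  also have "\<dots> = ennreal (unit_ball_vol (dim E - 1 :: nat) * (\<integral>x. h x ^ (dim E - 1) \<partial>sphere_prob E))"
    by (rule nn_integral_hyperplane_sections) (use assms in auto)
  finally show ?thesis
    using h by (simp add: integral_nonneg)
qed

end

section \<open>Star bodies\<close>

text \<open>At 0 the supremum in \<open>radial\<close> is over an unbounded set. Extension by zero
  off the sphere gives a function that is Borel, non-negative and bounded everywhere, as the polar
  formulas ask.\<close>

definition radial_ext :: "'a::euclidean_space set \<Rightarrow> 'a \<Rightarrow> real" where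
  "radial_ext K x = indicator (sphere 0 1) x * radial K x"

text \<open>The largest parameter on the ray exists by compactness and is positive because 0 is
  interior. The trace of \<open>K\<close> on the line is convex and contains 0, so it contains all
  smaller parameters.\<close>

lemma star_shaped_ray:
  assumes "star_shaped K" and \<theta>: "norm \<theta> = 1"
  shows "0 < radial K \<theta>" "t \<ge> 0 \<Longrightarrow> t *\<^sub>R \<theta> \<in> K \<longleftrightarrow> t \<le> radial K \<theta>"
proof -
  have K: "compact K" "0 \<in> interior K"
    using assms(1) by (auto simp: star_shaped_def)
  have conv: "convex (K \<inter> span {\<theta>})"
  proof -
    have "\<theta> \<noteq> 0" using \<theta> by auto
    then obtain a b where "K \<inter> span {\<theta>} = closed_segment a b"
      using assms(1) unfolding star_shaped_def by blast
    then show ?thesis by simp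
  qed
  obtain e where e: "e > 0" "cball 0 e \<subseteq> K"
    using K(2) by (auto simp: mem_interior_cball)
  define T where "T = {t. 0 \<le> t \<and> t *\<^sub>R \<theta> \<in> K}"
  have eT: "e \<in> T"
    using e \<theta> by (auto simp: T_def)
  obtain R where R: "\<And>x. x \<in> K \<Longrightarrow> norm x \<le> R"
    using compact_imp_bounded[OF K(1)] by (auto simp: bounded_iff)
  have "T = {0..R} \<inter> (\<lambda>t. t *\<^sub>R \<theta>) -` K"
    using R[of "_ *\<^sub>R \<theta>"] \<theta> by (force simp: T_def)
  moreover have "closed ({0..R} \<inter> (\<lambda>t. t *\<^sub>R \<theta>) -` K)"
    using compact_imp_closed[OF K(1)] by (intro continuous_closed_preimage continuous_intros) auto
  ultimately have "compact T"
    by (metis bounded_Int bounded_closed_interval cbox_interval compact_eq_bounded_closed)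
  then obtain s where s: "s \<in> T" "\<And>t. t \<in> T \<Longrightarrow> t \<le> s"
    using compact_attains_sup[of T] eT by auto
  have "s > 0"
    using s(2)[OF eT] e by simp
  then have rad: "radial K \<theta> = s"
    unfolding radial_def using s by (intro cSup_eq_maximum) (auto simp: T_def)
  show "0 < radial K \<theta>"
    using rad \<open>s > 0\<close> by simp
  show "t *\<^sub>R \<theta> \<in> K \<longleftrightarrow> t \<le> radial K \<theta>" if "t \<ge> 0"
  proof
    assume "t \<le> radial K \<theta>"
    have "s *\<^sub>R \<theta> \<in> K \<inter> span {\<theta>}" "0 \<in> K \<inter> span {\<theta>}"
      using s(1) K(2) interior_subset[of K] by (auto simp: T_def span_base span_scale span_0)
    from convexD_alt[OF conv this(2,1), of "t / s"] show "t *\<^sub>R \<theta> \<in> K"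
      using \<open>s > 0\<close> that \<open>t \<le> radial K \<theta>\<close> rad by simp
  qed (use s(2)[of t] that in \<open>auto simp: T_def rad\<close>)
qed

locale star_body_set =
  fixes K :: "'a::euclidean_space set"
  assumes star_body: "star_body K"
begin

lemma star_shaped: "star_shaped K"
  using star_body by (simp add: star_body_def)

lemma continuous_on_radial_ext: "continuous_on (sphere 0 1) (radial_ext K)"
  using star_body unfolding star_body_def
  by (auto simp: radial_ext_def elim!: continuous_on_eq)

lemma borel_measurable_radial_ext [measurable]: "radial_ext K \<in> borel_measurable borel"
  using borel_measurable_continuous_on_indicator[of "sphere 0 1" "radial K"] star_body
  by (simp add: star_body_def radial_ext_def[abs_def])

lemma radial_ext_nonneg: "0 \<le> radial_ext K x"
  using star_shaped_ray(1)[OF star_shaped, of x] by (auto simp: radial_ext_def indicator_def)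

text \<open>Brings a star body into the form of the polar formulas. The origin satisfies the
  condition since \<open>sgn 0 = 0\<close> and \<open>radial_ext K 0 = 0\<close>.\<close>

lemma star_body_eq: "K = {x. norm x \<le> radial_ext K (sgn x)}"
proof -
  have "x \<in> K \<longleftrightarrow> norm x \<le> radial_ext K (sgn x)" for x
  proof (cases "x = 0")
    case True
    have "0 \<in> K"
      using star_shaped interior_subset[of K] by (auto simp: star_shaped_def)
    with True show ?thesis
      by (simp add: radial_ext_nonneg)
  next
    case False
    then have *: "norm (sgn x) = 1" by (simp add: norm_sgn)
    have "x = norm x *\<^sub>R sgn x"
      using False by (simp add: sgn_div_norm)
    with star_shaped_ray(2)[OF star_shaped *, of "norm x"] show ?thesis
      using * by (simp add: radial_ext_def)
  qed
  then show ?thesis by blast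
qed

lemma radial_ext_bounds:
  obtains r R where "0 < r" "\<And>x. norm x = 1 \<Longrightarrow> r \<le> radial_ext K x" "\<And>x. radial_ext K x \<le> R"
proof -
  have ne: "sphere (0::'a) 1 \<noteq> {}"
    by simp
  obtain x0 where x0: "x0 \<in> sphere 0 1" "\<And>x. x \<in> sphere 0 1 \<Longrightarrow> radial_ext K x0 \<le> radial_ext K x"
    using continuous_attains_inf[OF compact_sphere ne continuous_on_radial_ext] by blast
  obtain x1 where x1: "x1 \<in> sphere 0 1" "\<And>x. x \<in> sphere 0 1 \<Longrightarrow> radial_ext K x \<le> radial_ext K x1"
    using continuous_attains_sup[OF compact_sphere ne continuous_on_radial_ext] by blast
  show ?thesis
  proof (rule that)
    show "0 < radial_ext K x0"
      using x0(1) star_shaped_ray(1)[OF star_shaped, of x0] by (simp add: radial_ext_def)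
    show "radial_ext K x0 \<le> radial_ext K x" if "norm x = 1" for x
      using x0(2) that by simp
    show "radial_ext K x \<le> radial_ext K x1" for x
      using x1(2)[of x] radial_ext_nonneg[of x1]
      by (cases "norm x = 1") (auto simp: radial_ext_def[of K x])
  qed
qed

lemma as_in_star_body:
  assumes "subspace E" "dim E > 0"
  shows "as_in E K = unit_ball_vol (dim E - 1 :: nat) * (\<integral>x. radial_ext K x ^ (dim E - 1) \<partial>sphere_prob E)"
proof -
  obtain R where "\<And>x. radial_ext K x \<le> R"
    using radial_ext_bounds by metis
  then show ?thesis
    by (subst star_body_eq, intro as_in_eq[OF assms])
      (auto simp: radial_ext_nonneg intro: continuous_on_subset[OF continuous_on_radial_ext])
qed

lemma integrable_radial_ext_power:
  assumes "subspace E" "dim E > 0"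
  shows "integrable (sphere_prob E) (\<lambda>x. radial_ext K x ^ j)"
proof -
  interpret invariant_sphere_measure E "sphere_prob E"
    by (rule invariant_sphere_prob[OF assms])
  obtain R where "\<And>x. radial_ext K x \<le> R"
    using radial_ext_bounds by metis
  then show ?thesis
    by (intro integrable_bounded_on_sphere[where B = "R ^ j"])
      (auto simp: radial_ext_nonneg power_mono)
qed

lemma integral_radial_ext_power_pos:
  assumes "subspace E" "dim E > 0"
  shows "0 < (\<integral>x. radial_ext K x ^ j \<partial>sphere_prob E)"
proof -
  interpret invariant_sphere_measure E "sphere_prob E"
    by (rule invariant_sphere_prob[OF assms])
  obtain r where r: "0 < r" "\<And>x. norm x = 1 \<Longrightarrow> r \<le> radial_ext K x"
    using radial_ext_bounds by metis
  have "(\<integral>x. r ^ j \<partial>sphere_prob E) \<le> (\<integral>x. radial_ext K x ^ j \<partial>sphere_prob E)"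
  proof (rule integral_mono_AE)
    show "AE x in sphere_prob E. r ^ j \<le> radial_ext K x ^ j"
      using AE_sphere by eventually_elim (use r in \<open>auto intro!: power_mono\<close>)
  qed (use integrable_radial_ext_power[OF assms] in auto)
  moreover have "0 < r ^ j" using r by simp
  ultimately show ?thesis by (simp add: measure_1)
qed

lemma as_in_pos:
  assumes "subspace E" "dim E > 0"
  shows "0 < as_in E K"
  unfolding as_in_star_body[OF assms]
  by (intro mult_pos_pos integral_radial_ext_power_pos assms) simp

text \<open>\<open>max_as\<close> is a supremum of reals and dominates its terms only for a bounded
  family. The maximal radius of \<open>K\<close> bounds all sections at once.\<close>

lemma bdd_above_as_in:
  assumes "m > 0"
  shows "bdd_above ((\<lambda>E. as_in E K) ` Gr m)"
proof -
  obtain R where R: "\<And>x. radial_ext K x \<le> R"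
    using radial_ext_bounds by metis
  show ?thesis
  proof (rule bdd_aboveI2)
    fix E :: "'a set" assume "E \<in> Gr m"
    then have E: "subspace E" "dim E = m" "dim E > 0"
      using assms by (auto simp: Gr_def)
    interpret S: invariant_sphere_measure E "sphere_prob E"
      by (rule invariant_sphere_prob[OF E(1,3)])
    have "(\<integral>x. radial_ext K x ^ (m - 1) \<partial>sphere_prob E) \<le> (\<integral>x. R ^ (m - 1) \<partial>sphere_prob E)"
      by (rule integral_mono)
        (use integrable_radial_ext_power[OF E(1,3)] R radial_ext_nonneg in \<open>auto intro!: power_mono\<close>)
    then show "as_in E K \<le> unit_ball_vol (m - 1 :: nat) * R ^ (m - 1)"
      unfolding as_in_star_body[OF E(1,3)] E(2) by (intro mult_left_mono) (auto simp: S.measure_1)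
  qed
qed

lemma measure_star_body:
  "measure lborel K = unit_ball_vol DIM('a) * (\<integral>x. radial_ext K x ^ DIM('a) \<partial>sphere_prob UNIV)"
proof -
  have n: "dim (UNIV :: 'a set) = DIM('a)" "dim (UNIV :: 'a set) > 0"
    by simp_all
  have "emeasure lborel K =
    (\<integral>\<^sup>+x. ennreal (radial_ext K (sgn x) ^ DIM('a)) * indicator (cball 0 1) x \<partial>lborel)"
    using emeasure_subspace_lborel_star[OF subspace_UNIV borel_measurable_radial_ext radial_ext_nonneg]
    by (subst star_body_eq) (simp add: subspace_lborel_UNIV)
  also have "\<dots> = ennreal (unit_ball_vol DIM('a)) * (ennreal (1 / unit_ball_vol DIM('a)) * \<dots>)"
    by (simp add: mult.assoc[symmetric] ennreal_mult[symmetric])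
  also have "\<dots> = ennreal (unit_ball_vol DIM('a)) * (\<integral>\<^sup>+x. ennreal (radial_ext K x ^ DIM('a)) \<partial>sphere_prob UNIV)"
    by (subst nn_integral_sphere_prob_cone[OF subspace_UNIV _ n(2)]) (simp_all add: subspace_lborel_UNIV)
  finally have "measure lborel K = enn2real (ennreal (unit_ball_vol DIM('a)) *
      (\<integral>\<^sup>+x. ennreal (radial_ext K x ^ DIM('a)) \<partial>sphere_prob UNIV))"
    by (simp add: measure_def)
  then show ?thesis
    using integrable_radial_ext_power[OF subspace_UNIV n(2)]
    by (simp add: nn_integral_eq_integral radial_ext_nonneg enn2real_mult integral_nonneg)
qed

end

lemma radial_ext_mono:
  assumes "star_body K" "star_body D" "K \<subseteq> D"
  shows "radial_ext K x \<le> radial_ext D x"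
proof (cases "norm x = 1")
  case True
  have "star_shaped K" "star_shaped D"
    using assms by (auto simp: star_body_def)
  note K = star_shaped_ray[OF this(1) True] and D = star_shaped_ray[OF this(2) True]
  have "radial K x *\<^sub>R x \<in> D"
    using K(1) K(2)[of "radial K x"] assms(3) by auto
  then show ?thesis
    using D(2)[of "radial K x"] K(1) by (simp add: radial_ext_def mult_left_mono)
qed (simp add: radial_ext_def)

lemma integral_sphere_measure:
  fixes f :: "'a::euclidean_space \<Rightarrow> real"
  assumes E: "subspace E" "dim E > 0" and [measurable]: "f \<in> borel_measurable borel" and f: "\<And>x. 0 \<le> f x"
  shows "(LINT x:sphere 0 1 \<inter> E|sphere_measure E. f x) =
    dim E * unit_ball_vol (dim E) * (\<integral>x. f x \<partial>sphere_prob E)"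
proof -
  have [measurable]: "E \<in> sets borel" "sphere (0::'a) 1 \<in> sets borel"
    by (simp_all add: closed_subspace[OF E(1)] borel_closed)
  have pos: "dim E * unit_ball_vol (dim E) > 0"
    using E(2) by (simp del: dim_eq_0)
  have "(LINT x:sphere 0 1 \<inter> E|sphere_measure E. f x) = (\<integral>x. f x \<partial>sphere_measure E)"
    unfolding set_lebesgue_integral_def
  proof (rule integral_cong_AE)
    show "AE x in sphere_measure E. indicator (sphere 0 1 \<inter> E) x *\<^sub>R f x = f x"
      using AE_sphere_measure[OF E] by eventually_elim simp
  qed measurable
  moreover have "(\<integral>x. f x \<partial>sphere_measure E) = enn2real (\<integral>\<^sup>+x. f x \<partial>sphere_measure E)"
    by (rule integral_eq_nn_integral) (auto simp: f)
  moreover have "(\<integral>x. f x \<partial>sphere_prob E) = enn2real (\<integral>\<^sup>+x. f x \<partial>sphere_prob E)"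
    by (rule integral_eq_nn_integral) (auto simp: f)
  ultimately show ?thesis
    using pos E(2)
    by (simp add: nn_integral_sphere_prob[OF E(1) _ E(2)] enn2real_mult del: dim_eq_0)
qed

text \<open>The weighted arithmetic-geometric mean inequality for y^n and 1, read off from convexity
  of exp between 0 and n ln y.\<close>

lemma power_le_weighted_mean:
  fixes y :: real
  assumes "0 \<le> y" "k \<le> n" "0 < k"
  shows "y ^ k \<le> k / n * y ^ n + (1 - k / n)"
proof (cases "y = 0")
  case True
  then show ?thesis using assms by (auto simp: zero_power)
next
  case False
  then have "y > 0" using assms by simp
  have "exp ((1 - k / n) *\<^sub>R 0 + (k / n) *\<^sub>R (n * ln y)) \<le> (1 - k / n) * exp 0 + k / n * exp (n * ln y)"
    using assms by (intro convex_onD[OF exp_convex]) (auto simp: divide_simps)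
  then show ?thesis
    using assms \<open>y > 0\<close> by (simp add: exp_of_nat_mult)
qed

section \<open>The inequality for a generalized intersection body\<close>

text \<open>Jensen's inequality for \<open>t \<mapsto> t\<^sup>n\<^sup>/\<^sup>k\<close>; the mean inequality is applied to \<open>\<rho>/a\<close> with
  \<open>a\<^sup>n = \<integral> \<rho>\<^sup>n\<close>.\<close>
lemma (in star_body_set) integral_radial_power_le:
  assumes k: "0 < k" "k \<le> DIM('a)"
  shows "(\<integral>x. radial_ext K x ^ k \<partial>sphere_prob UNIV) \<le>
    (measure lborel K / unit_ball_vol DIM('a)) powr (k / DIM('a))"
proof -
  let ?\<sigma> = "sphere_prob (UNIV :: 'a set)"
  define n where "n = DIM('a)"
  have n: "n > 0" "k \<le> n" by (simp_all add: n_def k)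
  have dim: "dim (UNIV :: 'a set) > 0" by simp
  interpret S: invariant_sphere_measure UNIV ?\<sigma>
    by (rule invariant_sphere_prob[OF subspace_UNIV dim])
  note int = integrable_radial_ext_power[OF subspace_UNIV dim]
  define I where "I = (\<integral>x. radial_ext K x ^ n \<partial>?\<sigma>)"
  have I: "measure lborel K / unit_ball_vol n = I"
    by (simp add: measure_star_body I_def n_def)
  have "I > 0"
    unfolding I_def by (rule integral_radial_ext_power_pos[OF subspace_UNIV dim])
  define a where "a = I powr (1 / n)"
  have a: "a > 0" "a ^ n = I" "a ^ k = I powr (k / n)"
    using \<open>I > 0\<close> n by (simp_all add: a_def powr_powr flip: powr_realpow)
  have "(\<integral>x. radial_ext K x ^ k / a ^ k \<partial>?\<sigma>) \<le> (\<integral>x. k / n * (radial_ext K x ^ n / a ^ n) + (1 - k / n) \<partial>?\<sigma>)"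
  proof (rule integral_mono)
    fix x
    show "radial_ext K x ^ k / a ^ k \<le> k / n * (radial_ext K x ^ n / a ^ n) + (1 - k / n)"
      using power_le_weighted_mean[of "radial_ext K x / a" k n] k n a radial_ext_nonneg[of x]
      by (simp add: power_divide)
  qed (use int in auto)
  also have "\<dots> = k / n * (I / a ^ n) + (1 - k / n)"
    using int by (simp add: I_def S.measure_1)
  also have "\<dots> = 1"
    using a(1) by (simp flip: a(2))
  finally have "(\<integral>x. radial_ext K x ^ k \<partial>?\<sigma>) \<le> a ^ k"
    using a(1) by (simp add: pos_divide_le_eq)
  then show ?thesis
    unfolding a(3) n_def[symmetric] I by simp
qed

text \<open>A non-integrable function has Bochner integral 0, and \<open>0 \<le> c\<close> covers
  that case. Hence the bound applies to \<open>Radon g\<close> on the Grassmannian directly from its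
  pointwise values.\<close>

lemma integral_le_const_finite_measure:
  fixes f :: "'a \<Rightarrow> real"
  assumes "finite_measure M" "0 \<le> c" "\<And>x. x \<in> space M \<Longrightarrow> f x \<le> c"
  shows "(\<integral>x. f x \<partial>M) \<le> c * measure M (space M)"
proof (cases "integrable M f")
  case True
  interpret finite_measure M by fact
  have "(\<integral>x. f x \<partial>M) \<le> (\<integral>x. c \<partial>M)"
    using True assms(3) by (intro integral_mono) auto
  then show ?thesis by (simp add: mult.commute)
qed (simp add: not_integrable_integral_eq assms)

text \<open>Both quantities are multiples of the mean of \<rho>_K^(m-1) over the sphere of
  \<open>H\<close>: by its surface area m \<omega>_m for \<open>Radon\<close>, and by \<omega>_{m-1}
  for \<open>as_in\<close>.\<close>

lemma (in star_body_set) Radon_radial_ext: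
  assumes "m > 0" "H \<in> Gr m"
  shows "Radon (\<lambda>x. radial_ext K x ^ (m - 1)) H =
    m * unit_ball_vol m / unit_ball_vol (m - 1 :: nat) * as_in H K"
proof -
  have H: "subspace H" "dim H = m" "dim H > 0"
    using assms by (auto simp: Gr_def)
  have "Radon (\<lambda>x. radial_ext K x ^ (m - 1)) H =
    m * unit_ball_vol m * (\<integral>x. radial_ext K x ^ (m - 1) \<partial>sphere_prob H)"
    unfolding Radon_def using integral_sphere_measure[OF H(1,3), of "\<lambda>x. radial_ext K x ^ (m - 1)"] H(2)
    by (simp add: radial_ext_nonneg)
  then show ?thesis
    using as_in_star_body[OF H(1,3)] H(2) by simp
qed

lemma Radon_1:
  assumes "m > 0" "H \<in> Gr m"
  shows "Radon (\<lambda>_. 1) H = m * unit_ball_vol m"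
proof -
  have H: "subspace H" "dim H = m" "dim H > 0"
    using assms by (auto simp: Gr_def)
  interpret invariant_sphere_measure H "sphere_prob H"
    by (rule invariant_sphere_prob[OF H(1,3)])
  show ?thesis
    unfolding Radon_def using integral_sphere_measure[OF H(1,3), of "\<lambda>_. 1"] H(2)
    by (simp add: measure_1)
qed

lemma (in star_body_set) max_as_ge:
  assumes "m > 0" "E \<in> Gr m"
  shows "as_in E K \<le> max_as m K"
  unfolding max_as_def using assms by (intro cSUP_upper bdd_above_as_in)

lemma (in star_body_set) max_as_pos:
  assumes "0 < m" "m \<le> DIM('a)"
  shows "0 < max_as m K"
proof -
  obtain E :: "'a set" where E: "subspace E" "dim E = m"
    using choose_subspace_of_subspace[of m "UNIV :: 'a set"] assms by (metis dim_UNIV)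
  have "0 < as_in E K"
    using E assms by (intro as_in_pos) auto
  also have "\<dots> \<le> max_as m K"
    using assms E by (intro max_as_ge) (auto simp: Gr_def)
  finally show ?thesis .
qed

lemma b_const_power:
  assumes "0 < k"
  shows "0 < b_const n k" "b_const n k ^ k = unit_ball_vol (n - 1 :: nat) /
     (unit_ball_vol (n - k - 1 :: nat) * unit_ball_vol n powr (k / n))"
proof -
  have pos: "0 < unit_ball_vol (n - 1 :: nat) /
     (unit_ball_vol (n - k - 1 :: nat) * unit_ball_vol n powr (k / n))"
    by (intro divide_pos_pos mult_pos_pos) auto
  then show "0 < b_const n k"
    unfolding b_const_def using assms by (simp only: real_root_gt_0_iff)
  show "b_const n k ^ k = unit_ball_vol (n - 1 :: nat) /
     (unit_ball_vol (n - k - 1 :: nat) * unit_ball_vol n powr (k / n))"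
    unfolding b_const_def using assms pos by (intro real_root_pow_pos) auto
qed

lemma (in star_body_set) avg_section_le:
  assumes k: "1 \<le> k" "k < DIM('a)" and D: "gen_intersection_body k D" "K \<subseteq> D"
  shows "avg_section K \<le> b_const DIM('a) k ^ k * measure lborel D powr (k / DIM('a)) * max_as (DIM('a) - k) K"
proof -
  define n where "n = DIM('a)"
  define m where "m = n - k"
  have m: "m > 0" "m \<le> n" "n - 1 = k + (m - 1)" "n > 0"
    using k by (auto simp: m_def n_def)
  let ?\<sigma> = "sphere_prob (UNIV :: 'a set)"
  have dim: "dim (UNIV :: 'a set) = n" "dim (UNIV :: 'a set) > 0"
    by (simp_all add: n_def)
  from D obtain \<mu> where starD: "star_body D" and \<mu>: "sets \<mu> = sets (Gr_borel m :: 'a set measure)" "finite_measure \<mu>"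
    and Radon: "\<And>g. continuous_on (sphere 0 1) g \<Longrightarrow>
          (LINT \<theta>:sphere 0 1|sphere_measure UNIV. radial D \<theta> ^ k * g \<theta>) = (LINT H|\<mu>. Radon g H)"
    unfolding gen_intersection_body_def m_def n_def by blast
  have space: "space \<mu> = Gr m"
    using sets_eq_imp_space_eq[OF \<mu>(1)] by (simp add: Gr_borel_def space_measure_of_conv)
  interpret D: star_body_set D
    by standard fact
  interpret S: invariant_sphere_measure UNIV ?\<sigma>
    by (rule invariant_sphere_prob[OF subspace_UNIV dim(2)])
  \<comment> \<open>The defining identity of \<open>D\<close>, rewritten with the normalised measure
    and the zero extension; n \<omega>_n is the area of the unit sphere.\<close>
  have Radon': "n * unit_ball_vol n * (\<integral>x. radial_ext D x ^ k * g x \<partial>?\<sigma>) = (LINT H|\<mu>. Radon g H)"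
    if g: "continuous_on (sphere 0 1) g" "g \<in> borel_measurable borel" "\<And>x. 0 \<le> g x" for g
  proof -
    have "(LINT \<theta>:sphere 0 1|sphere_measure UNIV. radial D \<theta> ^ k * g \<theta>) =
        (LINT \<theta>:sphere 0 1 \<inter> UNIV|sphere_measure UNIV. radial_ext D \<theta> ^ k * g \<theta>)"
      unfolding set_lebesgue_integral_def
      by (intro Bochner_Integration.integral_cong) (auto simp: indicator_def radial_ext_def)
    also have "\<dots> = n * unit_ball_vol n * (\<integral>x. radial_ext D x ^ k * g x \<partial>?\<sigma>)"
      using g by (subst integral_sphere_measure) (auto simp: D.radial_ext_nonneg n_def)
    finally show ?thesis
      using Radon[OF g(1)] by simp
  qed
  define W where "W = measure \<mu> (space \<mu>)"
  define M where "M = max_as m K"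
  have "M > 0"
    unfolding M_def using m by (intro max_as_pos) (auto simp: n_def)
  have total: "n * unit_ball_vol n * (\<integral>x. radial_ext D x ^ k \<partial>?\<sigma>) = m * unit_ball_vol m * W"
  proof -
    have "n * unit_ball_vol n * (\<integral>x. radial_ext D x ^ k \<partial>?\<sigma>) = (LINT H|\<mu>. Radon (\<lambda>_. 1) H)"
      using Radon'[of "\<lambda>_. 1"] by simp
    also have "\<dots> = (LINT H|\<mu>. m * unit_ball_vol m)"
      using m by (intro Bochner_Integration.integral_cong) (auto simp: space Radon_1)
    finally show ?thesis
      by (simp add: W_def mult_ac)
  qed
  have "avg_section K = unit_ball_vol (n - 1 :: nat) * (\<integral>x. radial_ext K x ^ (n - 1) \<partial>?\<sigma>)"
    unfolding avg_section_def using as_in_star_body[OF subspace_UNIV dim(2)] by (simp add: n_def)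
  also have "(\<integral>x. radial_ext K x ^ (n - 1) \<partial>?\<sigma>) \<le> (\<integral>x. radial_ext D x ^ k * radial_ext K x ^ (m - 1) \<partial>?\<sigma>)"
  proof (rule integral_mono)
    obtain R1 where R1: "\<And>x. radial_ext D x \<le> R1"
      using D.radial_ext_bounds by metis
    obtain R2 where R2: "\<And>x. radial_ext K x \<le> R2"
      using radial_ext_bounds by metis
    show "integrable ?\<sigma> (\<lambda>x. radial_ext D x ^ k * radial_ext K x ^ (m - 1))"
      by (rule S.integrable_bounded_on_sphere[where B = "R1 ^ k * R2 ^ (m - 1)"])
        (auto simp: abs_mult radial_ext_nonneg D.radial_ext_nonneg R1 R2 
          intro!: mult_mono power_mono zero_le_power order_trans[OF D.radial_ext_nonneg R1])
    show "radial_ext K x ^ (n - 1) \<le> radial_ext D x ^ k * radial_ext K x ^ (m - 1)" for x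
      unfolding m(3) power_add using radial_ext_mono[OF star_body starD D(2)]
      by (intro mult_right_mono power_mono) (auto simp: radial_ext_nonneg)
  qed (use integrable_radial_ext_power[OF subspace_UNIV dim(2)] in auto)
  \<comment> \<open>The test function is \<rho>_K^(m-1), admissible because the radial function of a
    star body is continuous.\<close>
  also have "(\<integral>x. radial_ext D x ^ k * radial_ext K x ^ (m - 1) \<partial>?\<sigma>) =
      (LINT H|\<mu>. Radon (\<lambda>x. radial_ext K x ^ (m - 1)) H) / (n * unit_ball_vol n)"
    using Radon'[of "\<lambda>x. radial_ext K x ^ (m - 1)", symmetric] m(4) 
    by (simp add: radial_ext_nonneg continuous_on_power continuous_on_radial_ext)
  also have "(LINT H|\<mu>. Radon (\<lambda>x. radial_ext K x ^ (m - 1)) H) \<le>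
      (m * unit_ball_vol m / unit_ball_vol (m - 1 :: nat) * M) * W"
    unfolding W_def
  proof (rule integral_le_const_finite_measure[OF \<mu>(2)])
    show "Radon (\<lambda>x. radial_ext K x ^ (m - 1)) H \<le> m * unit_ball_vol m / unit_ball_vol (m - 1 :: nat) * M"
      if "H \<in> space \<mu>" for H
      using that m(1) unfolding space M_def
      by (subst Radon_radial_ext, simp, simp, intro mult_left_mono max_as_ge) auto
  qed (use \<open>M > 0\<close> in auto)
  \<comment> \<open>\<open>total\<close> trades the mass \<open>W\<close> for the mean of
    \<rho>_D^k, and m \<omega>_m is absorbed in the exchange.\<close>
  also have "(m * unit_ball_vol m / unit_ball_vol (m - 1 :: nat) * M) * W =
     (n * unit_ball_vol n * (\<integral>x. radial_ext D x ^ k \<partial>?\<sigma>)) * M / unit_ball_vol (m - 1 :: nat)"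
    unfolding total by simp
  also have "unit_ball_vol (n - 1 :: nat) * (\<dots> / (n * unit_ball_vol n)) =
     unit_ball_vol (n - 1 :: nat) / unit_ball_vol (m - 1 :: nat) * M * (\<integral>x. radial_ext D x ^ k \<partial>?\<sigma>)"
    using m(4) by simp
  \<comment> \<open>Jensen's inequality supplies \<omega>_n^{-k/n}, the last factor of b^k.\<close>
  also have "\<dots> \<le> unit_ball_vol (n - 1 :: nat) / unit_ball_vol (m - 1 :: nat) * M *
      (measure lborel D / unit_ball_vol n) powr (k / n)"
    using D.integral_radial_power_le[of k] k \<open>M > 0\<close>
    by (intro mult_left_mono) (auto simp: n_def)
  also have "\<dots> = b_const n k ^ k * measure lborel D powr (k / n) * M"
    using k by (subst b_const_power(2)) (auto simp: powr_divide m_def)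
  finally show ?thesis
    by (simp add: M_def n_def m_def mult_left_mono divide_right_mono)
qed

section \<open>From a single D to the outer volume ratio distance\<close>

theorem theorem1p3:
  fixes K :: "(real ^ 'n) set" and k :: nat
  assumes "1 \<le> k" and "k \<le> CARD('n) - 1"
    and "star_body K" and "origin_symmetric K"
  shows "ereal (avg_section K) \<le>
           ereal (b_const CARD('n) k ^ k) * d_ovr k K ^ k *
           ereal (measure lborel K powr (k / CARD('n))) * ereal (max_as (CARD('n) - k) K)
         \<and> ereal (gamma_const k {K}) \<le> ereal (b_const CARD('n) k) * d_ovr k K"
proof -
  define n where "n = CARD('n)"
  have n: "DIM(real ^ 'n) = n" "n > 0" "k < n" "k > 0"
    using assms(1,2) by (auto simp: n_def Suc_le_eq)
  interpret star_body_set K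
    by standard fact
  define A b v M where "A = avg_section K" and "b = b_const n k" and "v = measure lborel K"
    and "M = max_as (n - k) K"
  have b: "b > 0"
    unfolding b_def by (rule b_const_power(1)[OF n(4)])
  have M: "M > 0"
    unfolding M_def using n by (intro max_as_pos) auto
  have A: "A > 0"
    unfolding A_def avg_section_def by (intro as_in_pos) auto
  have v: "v > 0"
    unfolding v_def measure_star_body
    by (intro mult_pos_pos integral_radial_ext_power_pos) auto
  define P where "P = b ^ k * v powr (k / n) * M"
  have P: "P > 0"
    using b v M by (simp add: P_def)
  \<comment> \<open>The exact factor in A = P q^k. Bounding \<open>q\<close> by the volume ratio of
    every admissible D yields a bound by their infimum, whether attained or not, and keeps the k-th
    power in the reals.\<close>
  define q where "q = root k (A / P)"
  have q: "q > 0" "A = P * q ^ k"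
    using A P n(4) by (auto simp: q_def)
  have le_ratio: "q \<le> (measure lborel D / v) powr (1 / n)" if D: "K \<subseteq> D" "gen_intersection_body k D" for D
  proof -
    define d where "d = (measure lborel D / v) powr (1 / n)"
    have "A \<le> b ^ k * measure lborel D powr (k / n) * M"
      using avg_section_le[of k D] n D by (simp add: A_def b_def M_def)
    also have "measure lborel D powr (k / n) = v powr (k / n) * d ^ k"
    proof (cases "measure lborel D = 0")
      case True
      then show ?thesis using n by (simp add: d_def)
    next
      case False
      then have "measure lborel D / v > 0"
        using v by (simp add: zero_less_measure_iff)
      then have "d > 0"
        unfolding d_def by (simp only: powr_gt_zero)
      then have "d ^ k = (measure lborel D / v) powr (k / n)"
        by (simp only: powr_realpow[symmetric]) (simp add: d_def powr_powr)
      then show ?thesis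
        using v by (simp add: powr_divide)
    qed
    finally have "P * q ^ k \<le> P * d ^ k"
      unfolding q(2)[symmetric] by (simp add: P_def mult_ac)
    then have "q ^ k \<le> d ^ k"
      using P by simp
    moreover have "d \<ge> 0" by (simp add: d_def)
    ultimately show ?thesis
      unfolding d_def[symmetric] using n(4) by (meson power_mono_iff less_imp_le q(1))
  qed
  have q_le: "ereal q \<le> d_ovr k K"
    unfolding d_ovr_def n(1) by (intro INF_greatest) (use le_ratio in \<open>auto simp: v_def\<close>)
  show ?thesis
  proof (cases "d_ovr k K")
    case (real x)
    with q_le have x: "q \<le> x" by simp
    then have "A \<le> P * x ^ k"
      using q P by (simp add: power_mono)
    then have ineq: "A \<le> (b * x) ^ k * v powr (k / n) * M"
      by (simp add: P_def power_mult_distrib mult_ac)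
    \<comment> \<open>The number b x is itself admissible in the infimum: \<open>ineq\<close> is the
      required inequality, and x \<ge> q > 0 gives strict positivity.\<close>
    have "gamma_const k {K} \<le> b * x"
      unfolding gamma_const_def
    proof (rule cInf_lower)
      show "b * x \<in> {\<gamma>. 0 < \<gamma> \<and> (\<forall>K\<in>{K}. avg_section K \<le>
        \<gamma> ^ k * measure lborel K powr (k / DIM(real ^ 'n)) * max_as (DIM(real ^ 'n) - k) K)}"
        using ineq b x q(1) unfolding n(1) by (simp add: A_def v_def M_def)
    qed (auto intro!: bdd_belowI[where m = 0])
    then show ?thesis
      using ineq unfolding n_def[symmetric] real
      by (simp add: A_def b_def v_def M_def power_mult_distrib)
  next
    \<comment> \<open>The infimum over no D at all. Since k, b and the remaining factors are
      positive, both right-hand sides are infinite.\<close>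
    case PInf
    then show ?thesis
      using b v M n(4) unfolding n_def[symmetric] PInf
      by (simp add: b_def v_def M_def)
  next
    case MInf
    with q_le show ?thesis by simp
  qed
qed

end
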